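(* Let $k,r\ge2$ be integers, let $\Gamma$ be the symmetric graph of type $k$ and order $r$ with vertex set $\mathcal V$, put $Q=(r-1)(k-1)$, $\alpha=\frac{Q+1}{r(k-1)}$, $\beta=\frac{2Q^{1/2}}{r(k-1)}$, and let $f,g:\mathcal V\to\mathbb C$. Consider the Cauchy problem for $u:\mathcal V\times\mathbb Z\to\mathbb C$ $$\begin{cases}\beta\,\mathcal L^{\mathbb Z}_n\,u(x,n)=(\mathcal L^{\Gamma}_x-(\alpha-\beta))\,u(x,n),\\ u(x,0)=f(x),\quad \{u(x,1)-u(x,-1)\}/2=g(x).\end{cases}$$ (i) When $k<r$, the solution is given by $u(x,0)=f(x)$ and, for $n\in\mathbb Z\setminus\{0\}$, $$\begin{aligned}u(x,n)=\;&\frac12\,Q^{-\frac{|n|}2}\sum_{d(x,y)=|n|}f(y)-\frac1{2k}\,Q^{-\frac{|n|}2}\sum_{0\le\ell<|n|}\{Q-1+(r-k)(1-k)^{|n|-\ell}\}\sum_{d(x,y)=\ell}f(y)\\&+\operatorname{sign}(n)\,Q^{-\frac{|n|-1}2}\sum_{d(x,y)=|n|-1}g(y)\\&+\operatorname{sign}(n)\,\frac1k\,Q^{-\frac{|n|-1}2}\Big\{\sum_{0\le d(x,y)<|n|-1}g(y)-\sum_{0\le\ell<|n|-1}(1-k)^{|n|-\ell}\sum_{d(x,y)=\ell}g(y)\Big\}.\end{aligned}$$ (ii) When $k=r$, the solution is given by $u(x,0)=f(x)$ and, for $n\in\mathbb Z\setminus\{0\}$, $$\begin{aligned}u(x,n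)=\;&\frac12\,(k-1)^{-|n|}\sum_{d(x,y)=|n|}f(y)-\frac{k-2}2\,(k-1)^{-|n|}\sum_{d(x,y)<|n|}f(y)\\&+\operatorname{sign}(n)\,(k-1)^{-(|n|-1)}\sum_{d(x,y)=|n|-1}g(y)\\&+\operatorname{sign}(n)\,\frac1k\,(k-1)^{-(|n|-1)}\Big\{\sum_{d(x,y)<|n|-1}g(y)+\sum_{0\le\ell<|n|-1}(k-1)^{|n|-\ell}\sum_{d(x,y)=\ell}g(y)\Big\}.\end{aligned}$$
   Context: Symmetric graph: $\Gamma$ is a connected graph in which every vertex $v$ belongs to exactly $r$ polygons with $k$ sides each (for $k=2$ a polygon is a single edge), these polygons having no side and no vertex in common except $v$, and such that every nontrivial loop runs through all the edges of at least one polygon. $\mathcal V$ is its vertex set. The distance $d(x,y)$ is the minimal number of polygons crossed by a path connecting $x$ with $y$; the sums are over $y\in\mathcal V$. The Laplacian on $\Gamma$ is $$\mathcal L^{\Gamma}f(x)=f(x)-\frac1{r(k-1)}\sum_{y:\,d(x,y)=1}f(y),$$ and the Laplacian on $\mathbb Z$ is $\mathcal L^{\mathbb Z}\phi(n)=\phi(n)-\frac{\phi(n+1)+\phi(n-1)}2$. Subscripts indicate the variable on which the operator acts. $\operatorname{sign}(n)=1$ for $n>0$ and $-1$ for $n<0$. Empty sums are zero.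
   Formalization: In (ii) the last sum is taken with −(1−k)^{|n|−ℓ} in place of the printed +(k−1)^{|n|−ℓ}, as in (i) at r=k; the printed sign is false, e.g. for k=r=2, Γ=ℤ, f=0, g=δ_x, n=2. *)

theory Defs
  imports Complex_Main "Graph_Theory.Graph_Theory"
begin

text \<open>
  Undirected graphs without parallel edges, possibly infinite, are symmetric loop-free pair digraphs
  (\<^locale>\<open>pair_bidirected_digraph\<close>): each edge is represented by its two arcs.
\<close>

definition sides :: "('a \<times> 'a) awalk \<Rightarrow> 'a set set" where
  "sides p = (\<lambda>(x, y). {x, y}) ` set p"

text \<open>
  A polygon with \<open>k\<close> sides is the set of edges of a cycle of length \<open>k\<close>, so that rotating or reversing
  the cycle does not change the polygon.  For \<open>k = 2\<close> the cycles of length 2 are the arc lists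
  \<open>[(x, y), (y, x)]\<close>, and the polygon is the single edge \<open>{x, y}\<close>.
\<close>

definition polygons :: "'a pair_pre_digraph \<Rightarrow> nat \<Rightarrow> 'a set set set" where
  "polygons G k = {sides p | p. pre_digraph.cycle (with_proj G) p \<and> length p = k}"

text \<open>
  A nontrivial loop is a cycle of length at least 3 (a cycle of length 2 goes along an edge and back).
  ``Runs through all the edges of a polygon'' is stated with arcs.  For \<open>k \<ge> 3\<close> this is the same as
  inclusion of the undirected sides, since a cycle containing all sides of a polygon is that polygon.
  For \<open>k = 2\<close> the loop would have to traverse an edge in both directions, which no
  cycle of length at least 3 does: there is no nontrivial loop, and the graph is the homogeneous tree
  of degree \<open>r\<close>.  (With undirected sides the condition would be void for \<open>k = 2\<close>.)

  The axiom \<open>edge_in_polygon\<close> is implicit in describing the graph by its polygons: without it,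
  bridges outside all polygons would be allowed when \<open>k \<ge> 3\<close>.
\<close>

locale symmetric_graph = pair_bidirected_digraph G
  for G :: "'a pair_pre_digraph" and k r :: nat +
  assumes graph_connected: "Digraph_Component.connected (with_proj G)"
    and edge_in_polygon: "(x, y) \<in> parcs G \<Longrightarrow> \<exists>P \<in> polygons G k. {x, y} \<in> P"
    and polygons_at_vertex: "v \<in> pverts G \<Longrightarrow> card {P \<in> polygons G k. v \<in> \<Union>P} = r"
    and polygons_meet:
      "\<lbrakk>v \<in> pverts G; P \<in> polygons G k; P' \<in> polygons G k; v \<in> \<Union>P; v \<in> \<Union>P'; P \<noteq> P'\<rbrakk>
        \<Longrightarrow> P \<inter> P' = {} \<and> \<Union>P \<inter> \<Union>P' = {v}"
    and loop_contains_polygon: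
      "\<lbrakk>pre_digraph.cycle (with_proj G) c; length c \<ge> 3\<rbrakk>
        \<Longrightarrow> \<exists>p. pre_digraph.cycle (with_proj G) p \<and> length p = k \<and> set p \<subseteq> set c"

text \<open>A walk crosses a polygon if it uses at least one of its sides.\<close>

definition polygon_dist :: "'a pair_pre_digraph \<Rightarrow> nat \<Rightarrow> 'a \<Rightarrow> 'a \<Rightarrow> nat" where
  "polygon_dist G k x y =
    (LEAST m. \<exists>p. pre_digraph.awalk (with_proj G) x p y \<and>
                  m = card {P \<in> polygons G k. P \<inter> sides p \<noteq> {}})"

definition laplacian_graph ::
    "'a pair_pre_digraph \<Rightarrow> nat \<Rightarrow> nat \<Rightarrow> ('a \<Rightarrow> complex) \<Rightarrow> 'a \<Rightarrow> complex" where
  "laplacian_graph G k r F x =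
    F x - 1 / (of_nat r * (of_nat k - 1)) *
      (\<Sum>y | y \<in> pverts G \<and> polygon_dist G k x y = 1. F y)"

definition laplacian_int :: "(int \<Rightarrow> complex) \<Rightarrow> int \<Rightarrow> complex" where
  "laplacian_int \<phi> n = \<phi> n - (\<phi> (n + 1) + \<phi> (n - 1)) / 2"

definition solves_cauchy_problem ::
    "'a pair_pre_digraph \<Rightarrow> nat \<Rightarrow> nat \<Rightarrow> real \<Rightarrow> real \<Rightarrow> ('a \<Rightarrow> complex) \<Rightarrow> ('a \<Rightarrow> complex)
      \<Rightarrow> ('a \<Rightarrow> int \<Rightarrow> complex) \<Rightarrow> bool" where
  "solves_cauchy_problem G k r \<alpha> \<beta> f g u \<longleftrightarrow>
    (\<forall>x \<in> pverts G.
      (\<forall>n. complex_of_real \<beta> * laplacian_int (\<lambda>m. u x m) n =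
            laplacian_graph G k r (\<lambda>y. u y n) x - complex_of_real (\<alpha> - \<beta>) * u x n) \<and>
      u x 0 = f x \<and>
      (u x 1 - u x (-1)) / 2 = g x)"

end

theory Submission
  imports Defs
begin

text \<open>
  Deleting the sides of a polygon \<open>P\<close> leaves the vertices of \<open>P\<close> in different components, since
  otherwise a cycle would exist that contains no polygon. Hence the distance of \<open>x\<close> and \<open>y\<close> is the
  number of polygons separating them, and a vertex \<open>y\<close> at distance \<open>m > 0\<close> from \<open>x\<close> has \<open>1\<close>, \<open>k - 2\<close>
  and \<open>(r - 1) (k - 1)\<close> neighbours at distance \<open>m - 1\<close>, \<open>m\<close> and \<open>m + 1\<close>.
  With \<open>q = sqrt Q\<close> the equation reads
  \<open>q (u(x, n + 1) + u(x, n - 1)) = (\<Sum>z\<sim>x. u(z, n)) - (k - 2) u(x, n)\<close>; it determines \<open>u\<close> from the initial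
  data, and on radial kernels it becomes a three-term recurrence in the coefficients.
  These depend on \<open>n - l\<close> only and are combinations of \<open>1\<close> and \<open>(1 - k)^(n - l)\<close>, the powers of the two
  roots of \<open>t\<^sup>2 + (k - 2) t - (k - 1)\<close>.
\<close>

section \<open>Polygons as separators\<close>

lemma sides_simps [simp]:
  "sides [] = {}"
  "sides (e # p) = insert {fst e, snd e} (sides p)"
  "sides (p @ q) = sides p \<union> sides q"
  by (auto simp: sides_def split: prod.splits)

lemma sides_rev_path [simp]: "sides (rev_path p) = sides p"
  by (induction p) (auto simp: insert_commute)

lemma sides_mono: "set p \<subseteq> set q \<Longrightarrow> sides p \<subseteq> sides q"
  by (auto simp: sides_def)

lemma in_sides_iff: "s \<in> sides p \<longleftrightarrow> (\<exists>e \<in> set p. s = {fst e, snd e})"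
  by (auto simp: sides_def image_iff case_prod_beta)

lemma arc_in_sides: "e \<in> set p \<Longrightarrow> {fst e, snd e} \<in> sides p"
  by (auto simp: in_sides_iff)

lemma finite_sides [simp]: "finite (sides p)"
  by (simp add: sides_def)

lemma Union_sides: "\<Union>(sides p) = fst ` set p \<union> snd ` set p"
  by (induction p) auto

section \<open>Closed walks and paths in digraphs\<close>

context wf_digraph
begin

lemma last_in_awalk_verts: "awalk u p v \<Longrightarrow> v \<in> set (awalk_verts u p)"
  by (induction p arbitrary: u) (auto simp: awalk_simps)

lemma awalk_tails_heads:
  "awalk u p v \<Longrightarrow> insert v (tail G ` set p) = insert u (head G ` set p)"
  by (induction p arbitrary: u) (auto simp: awalk_simps)

lemma closed_awalk_tails_heads:
  assumes "awalk u p u" "p \<noteq> []"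
  shows "tail G ` set p = head G ` set p"
proof -
  have "u \<in> tail G ` set p"
    using assms by (cases p) (auto simp: awalk_simps)
  moreover have "u \<in> head G ` set p"
    using assms by (cases p rule: rev_cases) (auto simp: awalk_simps)
  ultimately show ?thesis
    using awalk_tails_heads[OF assms(1)] by (simp add: insert_absorb)
qed

text \<open>The first arc of a path leaves a vertex that the path never enters again, whereas every
  tail on a cycle is also a head on it. So the first arc is not on the cycle, and the argument
  repeats on the rest of the path.\<close>

lemma apath_contains_no_cycle:
  assumes "apath u w v" "cycle c"
  shows "\<not> set c \<subseteq> set w"
  using assms(1)
proof (induction w arbitrary: u)
  case Nil
  show ?case using assms(2) by (auto simp: cycle_def)
next
  case (Cons e w)
  obtain x where c: "awalk x c x" "c \<noteq> []"
    using assms(2) by (auto simp: cycle_def)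
  from Cons.prems have w: "awalk (head G e) w v" "tail G e \<notin> set (awalk_verts (head G e) w)"
    by (auto simp: apath_Cons_iff awalkI_apath)
  show ?case
  proof
    assume sub: "set c \<subseteq> set (e # w)"
    have "e \<notin> set c"
    proof
      assume "e \<in> set c"
      then have "tail G e \<in> head G ` set c"
        using closed_awalk_tails_heads[OF c] by auto
      then have "tail G e \<in> set (awalk_verts (head G e) w)"
        using sub w(1) by (auto simp: set_awalk_verts)
      with w(2) show False by simp
    qed
    then have "set c \<subseteq> set w" using sub by auto
    with Cons show False by (auto simp: apath_Cons_iff)
  qed
qed

end

section \<open>Polygons as closed walks\<close>

context symmetric_graph
begin

text \<open>On a closed walk tails and heads are the same vertices, so the heads alone list the
  vertices of the polygon, each once.\<close>

lemma polygonE: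
  assumes "P \<in> polygons G k"
  obtains u p where "awalk u p u" "distinct (map snd p)" "p \<noteq> []" "length p = k" "P = sides p"
    "\<Union>P = snd ` set p" "\<Union>P = set (awalk_verts u p)"
proof -
  obtain p where p: "P = sides p" "cycle p" "length p = k"
    using assms by (auto simp: polygons_def)
  then obtain u where u: "awalk u p u" "distinct (tl (awalk_verts u p))" "p \<noteq> []"
    by (auto simp: cycle_def)
  have "awalk_verts u p = fst (hd p) # map snd p"
    using u by (subst awalk_verts_conv'[of _ _ u]) auto
  then have "distinct (map snd p)" using u(2) by simp
  moreover have "\<Union>P = snd ` set p"
    using closed_awalk_tails_heads[OF u(1,3)] p(1) by (simp add: Union_sides)
  moreover have "\<Union>P = set (awalk_verts u p)"
    using p(1) set_awalk_verts_not_Nil[OF u(1,3)] by (simp add: Union_sides)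
  ultimately show ?thesis using that u p by blast
qed

lemma card_polygon_vertices:
  assumes "P \<in> polygons G k"
  shows "card (\<Union>P) = k" "finite (\<Union>P)"
proof -
  from assms show "finite (\<Union>P)" by (rule polygonE) simp
  from assms show "card (\<Union>P) = k"
    by (rule polygonE) (metis distinct_card length_map set_map)
qed

lemma polygon_vertices_subset: "P \<in> polygons G k \<Longrightarrow> \<Union>P \<subseteq> pverts G"
  by (elim polygonE) (metis awalkE')

lemma edge_polygon_unique:
  assumes "P \<in> polygons G k" "P' \<in> polygons G k" "{u, v} \<in> P" "{u, v} \<in> P'"
  shows "P = P'"
proof (rule ccontr)
  assume "P \<noteq> P'"
  moreover have "u \<in> pverts G" using assms polygon_vertices_subset[of P] by blast
  ultimately show False using polygons_meet[of u P P'] assms by blast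
qed

text \<open>The closed walk around \<open>P\<close> is rotated to start at \<open>b\<close>, cut at
  \<open>a\<close>, and then shortened to a path.\<close>

lemma polygon_arc:
  assumes "P \<in> polygons G k" "a \<in> \<Union>P" "b \<in> \<Union>P"
  obtains p where "apath b p a" "sides p \<subseteq> P"
proof -
  obtain u p where p: "awalk u p u" "P = sides p" "\<Union>P = set (awalk_verts u p)"
    using polygonE[OF assms(1)] by metis
  obtain s t where st: "p = s @ t" "awalk u s b" "awalk b t u"
    using awalk_decomp[OF p(1), of b] assms(3) p(3) by auto
  have closed: "awalk b (t @ s) b" using st by (auto intro: awalk_appendI)
  have "set (awalk_verts b (t @ s)) = set (awalk_verts u p)"
    using st set_awalk_verts_append[OF st(3,2)] set_awalk_verts_append[OF st(2,3)] by auto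
  then have "a \<in> set (awalk_verts b (t @ s))" using assms(2) p(3) by simp
  then obtain q q' where q: "awalk b q a" "t @ s = q @ q'"
    using awalk_decomp[OF closed] by blast
  have "set q \<subseteq> set (t @ s)" by (simp only: q(2) set_append Un_upper1)
  then have "set q \<subseteq> set p" using st(1) by auto
  then have "apath b (awalk_to_apath q) a" "sides (awalk_to_apath q) \<subseteq> P"
    using apath_awalk_to_apath[OF q(1)] awalk_to_apath_subset[OF q(1)] p(2)
      \<open>set q \<subseteq> set p\<close> sides_mono[of "awalk_to_apath q" p] by auto
  then show ?thesis by (rule that)
qed

section \<open>Components of the graph after deleting the sides of a polygon\<close>

definition linked_off :: "'a set set \<Rightarrow> 'a \<Rightarrow> 'a \<Rightarrow> bool" where
  "linked_off P x y \<longleftrightarrow> (\<exists>p. awalk x p y \<and> sides p \<inter> P = {})"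

lemma linked_off_refl: "x \<in> pverts G \<Longrightarrow> linked_off P x x"
  unfolding linked_off_def by (rule exI[of _ "[]"]) (simp add: awalk_Nil_iff)

lemma linked_off_sym: "linked_off P x y \<Longrightarrow> linked_off P y x"
  unfolding linked_off_def by (metis awalk_rev_path sides_rev_path)

lemma linked_off_trans: "linked_off P x y \<Longrightarrow> linked_off P y z \<Longrightarrow> linked_off P x z"
  unfolding linked_off_def by (metis Int_Un_distrib2 Un_empty awalk_appendI sides_simps(3))

lemma linked_off_edge:
  assumes "e \<in> parcs G" "{fst e, snd e} \<notin> P"
  shows "linked_off P (fst e) (snd e)"
  unfolding linked_off_def using assms
  by (intro exI[of _ "[e]"]) (auto simp: awalk_simps arc_snd_in_verts)

text \<open>A shortest walk off \<open>P\<close> between two vertices of \<open>P\<close> closes up, along an arc of \<open>P\<close>, to a cycle;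
  the polygon contained in it is either \<open>P\<close> or shares no side with \<open>P\<close>, hence would lie in one of
  the two paths.\<close>

lemma polygon_vertices_not_linked_off:
  assumes P: "P \<in> polygons G k" and ab: "a \<in> \<Union>P" "b \<in> \<Union>P" "linked_off P a b"
  shows "a = b"
proof (rule ccontr)
  define good where
    "good w \<longleftrightarrow> (\<exists>a b. a \<in> \<Union>P \<and> b \<in> \<Union>P \<and> a \<noteq> b \<and> apath a w b \<and> sides w \<inter> P = {})" for w
  assume "a \<noteq> b"
  moreover obtain w0 where w0: "awalk a w0 b" "sides w0 \<inter> P = {}"
    using ab(3) by (auto simp: linked_off_def)
  moreover have "sides (awalk_to_apath w0) \<inter> P = {}"
    using sides_mono[OF awalk_to_apath_subset[OF w0(1)]] w0(2) by blast
  ultimately have "good (awalk_to_apath w0)"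
    using apath_awalk_to_apath[OF w0(1)] ab(1,2) unfolding good_def by blast
  then obtain w where good: "good w" and min: "\<And>w'. good w' \<Longrightarrow> length w \<le> length w'"
    by (metis ex_has_least_nat)
  \<comment> \<open>The names \<open>a\<close> and \<open>b\<close> are rebound: the shortest good
    path may join another pair of vertices of \<open>P\<close>.\<close>
  then obtain a b where w: "a \<in> \<Union>P" "b \<in> \<Union>P" "a \<noteq> b" "apath a w b" "sides w \<inter> P = {}"
    unfolding good_def by blast
  then have walk: "awalk a w b" by (simp add: apath_def)
  \<comment> \<open>A further vertex of \<open>P\<close> on \<open>w\<close> would cut off a shorter
    good path. Hence \<open>w\<close> meets the arc of \<open>P\<close> at its ends only, which
    makes \<open>w @ q\<close> a cycle.\<close>
  have interior: "x = a \<or> x = b" if x: "x \<in> set (awalk_verts a w)" "x \<in> \<Union>P" for x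
  proof (rule ccontr)
    assume "\<not> (x = a \<or> x = b)"
    obtain s t where st: "w = s @ t" "awalk a s x" "awalk x t b"
      using awalk_decomp[OF walk x(1)] by blast
    then have "apath a s x" using w(4) apath_append_iff[of a s t b] by auto
    then have "good s" using st x w \<open>\<not> (x = a \<or> x = b)\<close> unfolding good_def by auto
    then have "t = []" using min st(1) by fastforce
    then show False using st(3) \<open>\<not> (x = a \<or> x = b)\<close> by (simp add: awalk_Nil_iff)
  qed
  obtain q where q: "apath b q a" "sides q \<subseteq> P"
    using polygon_arc[OF P w(1,2)] .
  have walkq: "awalk b q a" using q(1) by (simp add: apath_def)
  have "w \<noteq> []" "q \<noteq> []" using walk walkq w(3) by (auto simp: awalk_Nil_iff)
  have verts_q: "set (awalk_verts b q) \<subseteq> \<Union>P"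
    using set_awalk_verts_not_Nil[OF walkq \<open>q \<noteq> []\<close>] Union_sides[of q] Union_mono[OF q(2)] by simp
  have vw: "awalk_verts a w = a # map snd w" "awalk_verts b q = b # map snd q"
    using awalk_verts_conv'[of a w b] awalk_verts_conv'[of b q a] walk walkq \<open>w \<noteq> []\<close> \<open>q \<noteq> []\<close>
    by (auto simp: awalk_def cas_simp)
  have closed: "awalk a (w @ q) a" using walk walkq by (rule awalk_appendI)
  have closed_verts: "awalk_verts a (w @ q) = a # map snd w @ map snd q"
    using awalk_verts_conv'[of a "w @ q" a] closed \<open>w \<noteq> []\<close> vw
    by (auto simp: awalk_def cas_simp)
  have "distinct (map snd w @ map snd q)"
  proof -
    have dw: "distinct (a # map snd w)" and dq: "distinct (b # map snd q)"
      using w(4) q(1) vw by (auto simp: apath_def)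
    have "x = b" if "x \<in> set (map snd w)" "x \<in> set (map snd q)" for x
    proof -
      have "x \<in> \<Union>P" using that(2) verts_q vw(2) by auto
      then have "x = a \<or> x = b" using interior[of x] vw(1) that(1) by auto
      then show ?thesis using that(1) dw by auto
    qed
    then have "set (map snd w) \<inter> set (map snd q) = {}"
      using dq unfolding distinct.simps(2) by blast
    then show ?thesis using dw dq by (simp only: distinct_append distinct.simps simp_thms)
  qed
  then have "distinct (tl (awalk_verts a (w @ q)))" by (simp only: closed_verts list.sel)
  then have "cycle (w @ q)"
    unfolding cycle_def using closed \<open>w \<noteq> []\<close> by blast
  \<comment> \<open>A closed walk of length 2 would use one edge in both directions, and this edge
    would be a side of \<open>P\<close> because of \<open>q\<close> and not a side because of
    \<open>w\<close>.\<close>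
  moreover have "3 \<le> length (w @ q)"
  proof (rule ccontr)
    assume "\<not> 3 \<le> length (w @ q)"
    moreover have "0 < length w" "0 < length q" using \<open>w \<noteq> []\<close> \<open>q \<noteq> []\<close> by blast+
    ultimately have "length w = Suc 0" "length q = Suc 0" unfolding length_append by linarith+
    then obtain e f where "w = [e]" "q = [f]" by (auto simp: length_Suc_conv)
    then have "w = [(a, b)]" "q = [(b, a)]"
      using walk walkq by (auto simp: awalk_simps prod_eq_iff)
    then have "{a, b} \<notin> P" "{b, a} \<in> P" using q(2) w(5) by simp_all
    then show False by (simp add: insert_commute)
  qed
  ultimately obtain p where p: "cycle p" "length p = k" "set p \<subseteq> set (w @ q)"
    using loop_contains_polygon by blast
  then have P': "sides p \<in> polygons G k" by (auto simp: polygons_def)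
  have in_P: "{fst e, snd e} \<in> P \<longleftrightarrow> sides p = P" if "e \<in> set p" for e
    using arc_in_sides[OF that] edge_polygon_unique[OF P P', of "fst e" "snd e"] by blast
  show False
  proof (cases "sides p = P")
    case True
    have "e \<in> set q" if "e \<in> set p" for e
      using that p(3) in_P[OF that] True w(5) arc_in_sides[of e w] by auto
    then show False using apath_contains_no_cycle[OF q(1) p(1)] by blast
  next
    case False
    have "e \<in> set w" if "e \<in> set p" for e
      using that p(3) in_P[OF that] False q(2) arc_in_sides[of e q] by auto
    then show False using apath_contains_no_cycle[OF w(4) p(1)] by blast
  qed
qed

text \<open>\<open>connected\<close> is weak connectedness; the symmetry of the arcs turns it into
  directed paths.\<close>

lemma apath_exists:
  assumes "x \<in> pverts G" "y \<in> pverts G"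
  obtains p where "apath x p y"
proof -
  have "strongly_connected (with_proj G)"
    using symmetric_connected_imp_strongly_connected[OF sym_arcs graph_connected] .
  then have "x \<rightarrow>\<^sup>*\<^bsub>with_proj G\<^esub> y" using assms by (auto elim: strongly_connectedE)
  then show ?thesis using that by (auto simp: reachable_apath)
qed

lemma edge_on_polygon:
  assumes "e \<in> parcs G"
  obtains P where "P \<in> polygons G k" "{fst e, snd e} \<in> P" "fst e \<in> \<Union>P" "snd e \<in> \<Union>P"
proof -
  obtain P where "P \<in> polygons G k" "{fst e, snd e} \<in> P"
    using edge_in_polygon[of "fst e" "snd e"] assms by auto
  then show ?thesis by (intro that[of P]) blast+
qed

text \<open>Up to its first vertex on \<open>P\<close> the walk uses no side of \<open>P\<close>,
  since both ends of a side lie on \<open>P\<close>.\<close>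

lemma linked_off_first_visit:
  assumes "awalk u p v" "set (awalk_verts u p) \<inter> \<Union>P \<noteq> {}"
  obtains b where "b \<in> set (awalk_verts u p)" "b \<in> \<Union>P" "linked_off P u b"
proof -
  have "\<exists>b \<in> set (awalk_verts u p). b \<in> \<Union>P \<and> linked_off P u b"
    using assms
  proof (induction p arbitrary: u)
    case Nil
    then show ?case using linked_off_refl by (auto simp: awalk_Nil_iff)
  next
    case (Cons e p)
    then have e: "e \<in> parcs G" "u = fst e" "awalk (snd e) p v"
      by (auto simp: awalk_Cons_iff)
    show ?case
    proof (cases "u \<in> \<Union>P")
      case True
      then show ?thesis using e linked_off_refl[of u P] arc_fst_in_verts by auto
    next
      case False
      then have "{fst e, snd e} \<notin> P" using e(2) by blast
      then have "linked_off P u (snd e)"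
        using linked_off_edge[of e P] e(1,2) by simp
      moreover obtain b where "b \<in> set (awalk_verts (snd e) p)" "b \<in> \<Union>P" "linked_off P (snd e) b"
        using Cons.IH[OF e(3)] Cons.prems(2) False e(2) by auto
      ultimately have "b \<in> set (awalk_verts u (e # p))" "linked_off P u b"
        using linked_off_trans by auto
      then show ?thesis using \<open>b \<in> \<Union>P\<close> by blast
    qed
  qed
  then show ?thesis using that by blast
qed

lemma linked_off_last_visit:
  assumes "awalk u p v" "set (awalk_verts u p) \<inter> \<Union>P \<noteq> {}"
  obtains b where "b \<in> set (awalk_verts u p)" "b \<in> \<Union>P" "linked_off P b v"
proof -
  have "awalk v (rev_path p) u" "set (awalk_verts v (rev_path p)) = set (awalk_verts u p)"
    using awalk_verts_rev_path[OF assms(1)] assms(1) by simp_all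
  then obtain b where "b \<in> set (awalk_verts u p)" "b \<in> \<Union>P" "linked_off P v b"
    using linked_off_first_visit[of v "rev_path p" u P] assms(2) by metis
  then show ?thesis using that linked_off_sym by blast
qed

lemma crossing_walk_meets_polygon:
  assumes "awalk u p v" "sides p \<inter> P \<noteq> {}"
  shows "set (awalk_verts u p) \<inter> \<Union>P \<noteq> {}"
proof -
  obtain e where "e \<in> set p" "{fst e, snd e} \<in> P"
    using assms(2) by (auto simp: in_sides_iff)
  moreover have "fst e \<in> set (awalk_verts u p)"
    using \<open>e \<in> set p\<close> set_awalk_verts[OF assms(1)] by auto
  ultimately show ?thesis by blast
qed

text \<open>Suppose that the first arc is a side of \<open>P\<close>. The remaining path visits
  \<open>P\<close> at some \<open>b\<close> linked to \<open>y\<close> off \<open>P\<close>, and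
  \<open>b\<close> differs from \<open>x\<close> because a path does not return; linking
  \<open>x\<close> to \<open>y\<close> would then link two vertices of \<open>P\<close>. If the
  first arc is not a side of \<open>P\<close>, its ends are linked and may be exchanged. Hence all
  paths between two vertices cross the same polygons.\<close>

lemma apath_crosses_iff:
  assumes "apath x p y" "P \<in> polygons G k"
  shows "sides p \<inter> P \<noteq> {} \<longleftrightarrow> \<not> linked_off P x y"
proof
  show "sides p \<inter> P \<noteq> {}" if "\<not> linked_off P x y"
    using that assms(1) by (auto simp: linked_off_def apath_def)
  show "\<not> linked_off P x y" if "sides p \<inter> P \<noteq> {}"
    using assms(1) that
  proof (induction p arbitrary: x)
    case Nil
    then show ?case by simp
  next
    case (Cons e p)
    from Cons.prems(1) have e: "e \<in> parcs G" "x = fst e" "apath (snd e) p y"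
      "x \<notin> set (awalk_verts (snd e) p)" "awalk (snd e) p y"
      by (auto simp: apath_Cons_iff awalkI_apath)
    show ?case
    proof (cases "{fst e, snd e} \<in> P")
      case True
      have "snd e \<in> set (awalk_verts (snd e) p)" using e(5) by (rule hd_in_awalk_verts)
      then have "set (awalk_verts (snd e) p) \<inter> \<Union>P \<noteq> {}" using True by blast
      then obtain b where b: "b \<in> set (awalk_verts (snd e) p)" "b \<in> \<Union>P" "linked_off P b y"
        using linked_off_last_visit[OF e(5)] by blast
      have "x \<in> \<Union>P" using True e(2) by blast
      moreover have "x \<noteq> b" using b(1) e(4) by blast
      ultimately show ?thesis
        using polygon_vertices_not_linked_off[OF assms(2), of x b] b
          linked_off_trans linked_off_sym by blast
    next
      case False
      then have "linked_off P x (snd e)"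
        using linked_off_edge[of e P] e(1,2) by simp
      moreover have "\<not> linked_off P (snd e) y"
        using Cons.IH[OF e(3)] Cons.prems(2) False by auto
      ultimately show ?thesis using linked_off_trans linked_off_sym by blast
    qed
  qed
qed

section \<open>Separating polygons and the polygon distance\<close>

definition separating :: "'a \<Rightarrow> 'a \<Rightarrow> 'a set set set" where
  "separating x y = {P \<in> polygons G k. \<not> linked_off P x y}"

lemma separating_sym: "separating x y = separating y x"
  unfolding separating_def using linked_off_sym by blast

lemma separating_refl: "x \<in> pverts G \<Longrightarrow> separating x x = {}"
  by (simp add: separating_def linked_off_refl)

lemma separating_triangle: "separating x z \<subseteq> separating x y \<union> separating y z"
  unfolding separating_def using linked_off_trans by blast

lemma apath_separating:
  assumes "apath x p y"
  shows "{P \<in> polygons G k. P \<inter> sides p \<noteq> {}} = separating x y"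
  using apath_crosses_iff[OF assms] unfolding separating_def by (auto simp: Int_commute)

text \<open>Each crossed polygon contains a side of the walk, and that side belongs to no other
  polygon, so the finitely many sides determine all crossed polygons.\<close>

lemma finite_crossed: "finite {P \<in> polygons G k. P \<inter> sides p \<noteq> {}}"
proof (rule finite_subset)
  show "finite ((\<lambda>s. THE P. P \<in> polygons G k \<and> s \<in> P) ` sides p)" by simp
  show "{P \<in> polygons G k. P \<inter> sides p \<noteq> {}} \<subseteq> (\<lambda>s. THE P. P \<in> polygons G k \<and> s \<in> P) ` sides p"
  proof
    fix P assume "P \<in> {P \<in> polygons G k. P \<inter> sides p \<noteq> {}}"
    then obtain e where e: "P \<in> polygons G k" "e \<in> set p" "{fst e, snd e} \<in> P"
      by (auto simp: in_sides_iff)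
    have "(THE P. P \<in> polygons G k \<and> {fst e, snd e} \<in> P) = P"
      using e(1,3) edge_polygon_unique by (intro the_equality conjI) metis+
    then show "P \<in> (\<lambda>s. THE P. P \<in> polygons G k \<and> s \<in> P) ` sides p"
      by (intro image_eqI[OF _ arc_in_sides[OF e(2)]]) (rule sym)
  qed
qed

text \<open>A walk that misses a polygon links its ends off it, so every walk crosses all separating
  polygons; a path crosses no others and attains the minimum.\<close>

lemma
  assumes "x \<in> pverts G" "y \<in> pverts G"
  shows finite_separating: "finite (separating x y)"
    and polygon_dist_eq_card_separating: "polygon_dist G k x y = card (separating x y)"
proof -
  obtain p where p: "apath x p y" using apath_exists[OF assms] .
  show "finite (separating x y)"
    using finite_crossed[of p] by (simp add: apath_separating[OF p])
  show "polygon_dist G k x y = card (separating x y)"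
    unfolding polygon_dist_def
  proof (rule Least_equality)
    show "\<exists>p. awalk x p y \<and> card (separating x y) = card {P \<in> polygons G k. P \<inter> sides p \<noteq> {}}"
      using awalkI_apath[OF p] by (intro exI[of _ p]) (simp add: apath_separating[OF p])
  next
    fix m assume "\<exists>p. awalk x p y \<and> m = card {P \<in> polygons G k. P \<inter> sides p \<noteq> {}}"
    then obtain q where q: "awalk x q y" "m = card {P \<in> polygons G k. P \<inter> sides q \<noteq> {}}"
      by blast
    have "separating x y \<subseteq> {P \<in> polygons G k. P \<inter> sides q \<noteq> {}}"
      using q(1) by (auto simp: separating_def linked_off_def Int_commute)
    then show "card (separating x y) \<le> m"
      using q(2) card_mono[OF finite_crossed] by simp
  qed
qed

lemma polygon_dist_sym:
  "x \<in> pverts G \<Longrightarrow> y \<in> pverts G \<Longrightarrow> polygon_dist G k x y = polygon_dist G k y x"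
  by (simp add: polygon_dist_eq_card_separating separating_sym)

lemma polygon_dist_triangle:
  assumes "x \<in> pverts G" "y \<in> pverts G" "z \<in> pverts G"
  shows "polygon_dist G k x z \<le> polygon_dist G k x y + polygon_dist G k y z"
proof -
  have "card (separating x z) \<le> card (separating x y \<union> separating y z)"
    using assms by (intro card_mono separating_triangle) (auto intro: finite_separating)
  also have "\<dots> \<le> card (separating x y) + card (separating y z)" by (rule card_Un_le)
  finally show ?thesis using assms by (simp add: polygon_dist_eq_card_separating)
qed

lemma polygon_dist_eq_0_iff:
  assumes "x \<in> pverts G" "y \<in> pverts G"
  shows "polygon_dist G k x y = 0 \<longleftrightarrow> x = y"
proof
  assume "polygon_dist G k x y = 0"
  then have sep: "separating x y = {}"
    using assms by (simp add: polygon_dist_eq_card_separating finite_separating)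
  obtain p where p: "apath x p y" using apath_exists[OF assms] .
  have "p = []"
  proof (rule ccontr)
    assume "p \<noteq> []"
    then obtain e q where e: "p = e # q" by (cases p) auto
    then obtain P where "P \<in> polygons G k" "{fst e, snd e} \<in> P"
      using p edge_on_polygon[of e] by (auto simp: apath_Cons_iff)
    then show False using apath_separating[OF p] sep e by auto
  qed
  then show "x = y" using p by (simp add: apath_Nil_iff)
qed (use assms in \<open>simp add: polygon_dist_eq_card_separating separating_refl\<close>)

text \<open>Going round \<open>P\<close> from \<open>y\<close> to \<open>z\<close> uses sides of
  \<open>P\<close> only, and none of them is shared with \<open>P'\<close>.\<close>

lemma linked_off_other_polygon:
  assumes "P \<in> polygons G k" "P' \<in> polygons G k" "P \<noteq> P'" "y \<in> \<Union>P" "z \<in> \<Union>P"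
  shows "linked_off P' y z"
proof -
  obtain q where q: "apath y q z" "sides q \<subseteq> P"
    using polygon_arc[OF assms(1,5,4)] .
  have "s \<notin> P'" if "s \<in> sides q" for s
  proof -
    obtain e where "s = {fst e, snd e}" using \<open>s \<in> sides q\<close> by (auto simp: in_sides_iff)
    then show ?thesis using that q(2) edge_polygon_unique[OF assms(1,2)] assms(3) by blast
  qed
  then have "sides q \<inter> P' = {}" by blast
  then show ?thesis using q(1) by (auto simp: linked_off_def apath_def)
qed

text \<open>Serves to compare the distances to two vertices of one polygon: only \<open>P\<close>
  itself can make a difference.\<close>

lemma separating_off_polygon:
  assumes "P \<in> polygons G k" "y \<in> \<Union>P" "z \<in> \<Union>P"
  shows "separating x z - {P} = separating x y - {P}"
  using linked_off_other_polygon[OF assms(1)] assms(2,3) linked_off_trans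
  unfolding separating_def by blast

text \<open>If a single polygon \<open>P\<close> separates the vertices, every edge of a path
  between them lies on \<open>P\<close>, and so do both ends. Conversely, distinct vertices of
  \<open>P\<close> are separated by \<open>P\<close> and by nothing else. Vertices at distance 1
  need therefore not be adjacent.\<close>

lemma polygon_dist_eq_1_iff:
  assumes "x \<in> pverts G" "y \<in> pverts G"
  shows "polygon_dist G k x y = 1 \<longleftrightarrow> x \<noteq> y \<and> (\<exists>P \<in> polygons G k. x \<in> \<Union>P \<and> y \<in> \<Union>P)"
proof
  assume dist: "polygon_dist G k x y = 1"
  then have "x \<noteq> y" using polygon_dist_eq_0_iff[OF assms] by auto
  obtain P where P: "separating x y = {P}"
    using dist assms by (auto simp: polygon_dist_eq_card_separating card_1_singleton_iff)
  obtain p where p: "apath x p y" using apath_exists[OF assms] .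
  then have walk: "awalk x p y" by (rule awalkI_apath)
  have "p \<noteq> []" using p \<open>x \<noteq> y\<close> by (auto simp: apath_Nil_iff)
  have "\<Union>(sides p) \<subseteq> \<Union>P"
  proof (rule Union_mono, rule subsetI)
    fix s assume s: "s \<in> sides p"
    then obtain e where e: "e \<in> set p" "s = {fst e, snd e}" by (auto simp: in_sides_iff)
    then obtain P' where P': "P' \<in> polygons G k" "s \<in> P'"
      using edge_on_polygon[of e] walk by (auto simp: awalk_def)
    then have "P' \<in> separating x y" using apath_separating[OF p] s by blast
    then show "s \<in> P" using P' P by simp
  qed
  then have "set (awalk_verts x p) \<subseteq> \<Union>P"
    using set_awalk_verts_not_Nil[OF walk \<open>p \<noteq> []\<close>] by (simp add: Union_sides)
  moreover have "x \<in> set (awalk_verts x p)" using walk by (rule hd_in_awalk_verts)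
  moreover have "y \<in> set (awalk_verts x p)"
    using walk by (rule last_in_awalk_verts)
  ultimately have "x \<in> \<Union>P" "y \<in> \<Union>P" by (simp_all only: subset_iff)
  moreover have "P \<in> polygons G k" using P by (auto simp: separating_def)
  ultimately show "x \<noteq> y \<and> (\<exists>P \<in> polygons G k. x \<in> \<Union>P \<and> y \<in> \<Union>P)"
    using \<open>x \<noteq> y\<close> by blast
next
  assume "x \<noteq> y \<and> (\<exists>P \<in> polygons G k. x \<in> \<Union>P \<and> y \<in> \<Union>P)"
  then obtain P where P: "x \<noteq> y" "P \<in> polygons G k" "x \<in> \<Union>P" "y \<in> \<Union>P" by blast
  have "separating x y = {P}"
    using separating_off_polygon[OF P(2-4), of x] polygon_vertices_not_linked_off[OF P(2-4)] P(1,2)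
      separating_refl[OF assms(1)] unfolding separating_def by blast
  then show "polygon_dist G k x y = 1" using assms by (simp add: polygon_dist_eq_card_separating)
qed

text \<open>It is the polygon of the first edge on a path from \<open>y\<close> to \<open>x\<close>.
  Another separating polygon \<open>P'\<close> through \<open>y\<close> would be met again by the
  rest of the path, at a vertex linked to \<open>y\<close> off \<open>P'\<close>; this vertex would
  be \<open>y\<close> itself, to which a path does not return.\<close>

lemma ex1_polygon_towards:
  assumes "x \<in> pverts G" "y \<in> pverts G" "x \<noteq> y"
  shows "\<exists>!P. P \<in> polygons G k \<and> y \<in> \<Union>P \<and> \<not> linked_off P x y"
proof -
  obtain p where p: "apath y p x" using apath_exists[OF assms(2,1)] .
  then obtain e q where e: "p = e # q" "e \<in> parcs G" "fst e = y" "awalk (snd e) q x"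
      "y \<notin> set (awalk_verts (snd e) q)"
    using assms(3) by (cases p) (auto simp: apath_simps awalkI_apath)
  obtain P where P: "P \<in> polygons G k" "{fst e, snd e} \<in> P" "y \<in> \<Union>P"
    using edge_on_polygon[OF e(2)] e(3) by blast
  show ?thesis
  proof (rule ex1I[of _ P])
    have "\<not> linked_off P y x" using apath_crosses_iff[OF p P(1)] P(2) e(1) by simp
    then show "P \<in> polygons G k \<and> y \<in> \<Union>P \<and> \<not> linked_off P x y"
      using P linked_off_sym by blast
  next
    fix P' assume P': "P' \<in> polygons G k \<and> y \<in> \<Union>P' \<and> \<not> linked_off P' x y"
    show "P' = P"
    proof (rule ccontr)
      assume "P' \<noteq> P"
      then have "{fst e, snd e} \<notin> P'" using edge_polygon_unique[OF P(1)] P' P(2) by metis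
      then have linked: "linked_off P' y (snd e)"
        using linked_off_edge[of e P'] e(2,3) by simp
      have "sides q \<inter> P' \<noteq> {}"
        using apath_crosses_iff[OF p, of P'] P' \<open>{fst e, snd e} \<notin> P'\<close> linked_off_sym e(1) by auto
      then obtain b where b: "b \<in> set (awalk_verts (snd e) q)" "b \<in> \<Union>P'" "linked_off P' (snd e) b"
        using linked_off_first_visit[OF e(4)] crossing_walk_meets_polygon[OF e(4)] by metis
      then have "y = b"
        using polygon_vertices_not_linked_off[of P' y b] linked_off_trans[OF linked b(3)] P' by blast
      then show False using b(1) e(5) by simp
    qed
  qed
qed

text \<open>A walk from \<open>x\<close> into \<open>P\<close> enters it at a linked vertex, and no
  two vertices of \<open>P\<close> are linked. This gate is the vertex of \<open>P\<close> nearest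
  to \<open>x\<close>; the others are one step farther.\<close>

lemma ex1_gate:
  assumes "P \<in> polygons G k" "x \<in> pverts G"
  shows "\<exists>!z. z \<in> \<Union>P \<and> linked_off P x z"
proof -
  obtain y where y: "y \<in> \<Union>P" using assms(1) by (rule polygonE) (metis equals0I image_is_empty set_empty)
  then have "y \<in> pverts G" using polygon_vertices_subset[OF assms(1)] by blast
  then obtain p where p: "awalk x p y" using apath_exists[OF assms(2)] awalkI_apath by metis
  then have "y \<in> set (awalk_verts x p)"
    by (rule last_in_awalk_verts)
  then obtain z where "z \<in> \<Union>P" "linked_off P x z"
    using linked_off_first_visit[OF p, of P] y by blast
  then show ?thesis
    using polygon_vertices_not_linked_off[OF assms(1)] linked_off_sym linked_off_trans by metis
qed

section \<open>Sums over neighbours and radial kernels\<close>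

lemma neighbours_eq:
  assumes "y \<in> pverts G"
  shows "{z. z \<in> pverts G \<and> polygon_dist G k y z = 1} =
    (\<Union>P \<in> {P \<in> polygons G k. y \<in> \<Union>P}. \<Union>P - {y})"
proof (intro equalityI subsetI)
  fix z assume "z \<in> {z. z \<in> pverts G \<and> polygon_dist G k y z = 1}"
  then obtain P where P: "P \<in> polygons G k" "y \<in> \<Union>P" "z \<in> \<Union>P" "y \<noteq> z"
    using polygon_dist_eq_1_iff[OF assms, of z] by auto
  show "z \<in> (\<Union>P \<in> {P \<in> polygons G k. y \<in> \<Union>P}. \<Union>P - {y})"
    by (rule UN_I[of P]) (use P in simp_all)
next
  fix z assume "z \<in> (\<Union>P \<in> {P \<in> polygons G k. y \<in> \<Union>P}. \<Union>P - {y})"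
  then obtain P where P: "P \<in> {P \<in> polygons G k. y \<in> \<Union>P}" "z \<in> \<Union>P - {y}" by (rule UN_E)
  then have P': "P \<in> polygons G k" "y \<in> \<Union>P" "z \<in> \<Union>P" "y \<noteq> z" by auto
  have z: "z \<in> pverts G" using subsetD[OF polygon_vertices_subset[OF P'(1)] P'(3)] .
  have "polygon_dist G k y z = 1"
    unfolding polygon_dist_eq_1_iff[OF assms z] using P' by (intro conjI bexI[of _ P])
  then show "z \<in> {z. z \<in> pverts G \<and> polygon_dist G k y z = 1}" using z by simp
qed

text \<open>An infinite set has cardinality 0, so a positive count includes finiteness.\<close>

lemma finite_polygons_at: "r > 0 \<Longrightarrow> y \<in> pverts G \<Longrightarrow> finite {P \<in> polygons G k. y \<in> \<Union>P}"
  using polygons_at_vertex[of y] by (intro card_ge_0_finite) simp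

lemma finite_neighbours:
  assumes "r > 0" "y \<in> pverts G"
  shows "finite {z. z \<in> pverts G \<and> polygon_dist G k y z = 1}"
  unfolding neighbours_eq[OF assms(2)]
  using finite_polygons_at[OF assms] card_polygon_vertices(2) by (intro finite_UN_I) auto

text \<open>Two polygons at \<open>y\<close> have only \<open>y\<close> in common, so the neighbours
  fall into disjoint blocks.\<close>

lemma sum_neighbours:
  fixes F :: "'a \<Rightarrow> 'b :: comm_monoid_add"
  assumes "r > 0" "y \<in> pverts G"
  shows "(\<Sum>z | z \<in> pverts G \<and> polygon_dist G k y z = 1. F z) =
    (\<Sum>P | P \<in> polygons G k \<and> y \<in> \<Union>P. \<Sum>z \<in> \<Union>P - {y}. F z)"
  unfolding neighbours_eq[OF assms(2)]
proof (rule sum.UNION_disjoint)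
  show "finite {P \<in> polygons G k. y \<in> \<Union>P}" using finite_polygons_at[OF assms] .
  show "\<forall>P\<in>{P \<in> polygons G k. y \<in> \<Union>P}. finite (\<Union>P - {y})"
    using card_polygon_vertices(2) by blast
  show "\<forall>P\<in>{P \<in> polygons G k. y \<in> \<Union>P}. \<forall>P'\<in>{P \<in> polygons G k. y \<in> \<Union>P}.
      P \<noteq> P' \<longrightarrow> (\<Union>P - {y}) \<inter> (\<Union>P' - {y}) = {}"
    using polygons_meet[OF assms(2)] by blast
qed

text \<open>Passing from the gate \<open>y\<close> to another vertex of \<open>P\<close> adds
  \<open>P\<close> to the separating polygons and changes no other.\<close>

lemma polygon_dist_Suc:
  assumes "P \<in> polygons G k" "x \<in> pverts G" "y \<in> \<Union>P" "z \<in> \<Union>P" "linked_off P x y" "z \<noteq> y"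
  shows "polygon_dist G k x z = Suc (polygon_dist G k x y)"
proof -
  have verts: "y \<in> pverts G" "z \<in> pverts G"
    using assms(3,4) polygon_vertices_subset[OF assms(1)] by blast+
  have "\<not> linked_off P x z"
    using polygon_vertices_not_linked_off[OF assms(1,4,3)] assms(5,6)
      linked_off_sym linked_off_trans by blast
  then have "P \<in> separating x z" "P \<notin> separating x y"
    using assms(1,5) by (auto simp: separating_def)
  then have "separating x z = insert P (separating x y)"
    using separating_off_polygon[OF assms(1,3,4), of x] by blast
  then show ?thesis
    using \<open>P \<notin> separating x y\<close> finite_separating[OF assms(2) verts(1)] assms(2) verts
    by (simp add: polygon_dist_eq_card_separating)
qed

text \<open>If \<open>y\<close> is the gate of \<open>P\<close> seen from \<open>x\<close>, the
  other \<open>k - 1\<close> vertices are one step farther. Otherwise the gate is one step nearer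
  and the remaining \<open>k - 2\<close> vertices are as far away as \<open>y\<close>; the distance
  is then positive, so the truncated \<open>- 1\<close> is exact.\<close>

lemma
  fixes F :: "nat \<Rightarrow> 'b :: comm_semiring_1"
  assumes "P \<in> polygons G k" "x \<in> pverts G" "y \<in> \<Union>P"
  shows sum_polygon_away: "linked_off P x y \<Longrightarrow>
      (\<Sum>z \<in> \<Union>P - {y}. F (polygon_dist G k x z)) = of_nat (k - 1) * F (Suc (polygon_dist G k x y))"
    and sum_polygon_towards: "\<not> linked_off P x y \<Longrightarrow>
      (\<Sum>z \<in> \<Union>P - {y}. F (polygon_dist G k x z)) =
        F (polygon_dist G k x y - 1) + of_nat (k - 2) * F (polygon_dist G k x y)"
proof -
  assume "linked_off P x y"
  then have "(\<Sum>z \<in> \<Union>P - {y}. F (polygon_dist G k x z)) =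
      (\<Sum>z \<in> \<Union>P - {y}. F (Suc (polygon_dist G k x y)))"
    using polygon_dist_Suc[OF assms] by (intro sum.cong) auto
  then show "(\<Sum>z \<in> \<Union>P - {y}. F (polygon_dist G k x z)) =
      of_nat (k - 1) * F (Suc (polygon_dist G k x y))"
    using card_polygon_vertices[OF assms(1)] assms(3) by simp
next
  assume away: "\<not> linked_off P x y"
  obtain w where w: "w \<in> \<Union>P" "linked_off P x w"
    using ex1_implies_ex[OF ex1_gate[OF assms(1,2)]] by blast
  have "w \<noteq> y" using w away by auto
  have dist: "polygon_dist G k x z = Suc (polygon_dist G k x w)" if "z \<in> \<Union>P" "z \<noteq> w" for z
    using polygon_dist_Suc[OF assms(1,2) w(1) _ w(2)] that by blast
  have "(\<Sum>z \<in> \<Union>P - {y}. F (polygon_dist G k x z)) =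
      F (polygon_dist G k x w) + (\<Sum>z \<in> \<Union>P - {y} - {w}. F (polygon_dist G k x z))"
    using w(1) \<open>w \<noteq> y\<close> card_polygon_vertices[OF assms(1)] by (intro sum.remove) auto
  also have "(\<Sum>z \<in> \<Union>P - {y} - {w}. F (polygon_dist G k x z)) =
      (\<Sum>z \<in> \<Union>P - {y} - {w}. F (polygon_dist G k x y))"
    using dist assms(3) \<open>w \<noteq> y\<close> by (intro sum.cong) auto
  also have "\<dots> = of_nat (k - 2) * F (polygon_dist G k x y)"
  proof -
    have "card (\<Union>P - {y} - {w}) = k - 2"
      using card_polygon_vertices[OF assms(1)] w(1) assms(3) \<open>w \<noteq> y\<close> by (simp add: card_Diff_singleton)
    then show ?thesis by simp
  qed
  finally show "(\<Sum>z \<in> \<Union>P - {y}. F (polygon_dist G k x z)) =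
        F (polygon_dist G k x y - 1) + of_nat (k - 2) * F (polygon_dist G k x y)"
    using dist[OF assms(3)] \<open>w \<noteq> y\<close> by simp
qed

lemma sum_neighbours_dist_refl:
  fixes F :: "nat \<Rightarrow> 'b :: comm_semiring_1"
  assumes "r > 0" "x \<in> pverts G"
  shows "(\<Sum>z | z \<in> pverts G \<and> polygon_dist G k x z = 1. F (polygon_dist G k x z)) =
    of_nat (r * (k - 1)) * F 1"
proof -
  have "(\<Sum>z | z \<in> pverts G \<and> polygon_dist G k x z = 1. F (polygon_dist G k x z)) =
      (\<Sum>P | P \<in> polygons G k \<and> x \<in> \<Union>P. of_nat (k - 1) * F 1)"
    unfolding sum_neighbours[OF assms]
    using sum_polygon_away[of _ x x F] assms(2) linked_off_refl polygon_dist_eq_0_iff[OF assms(2) assms(2)]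
    by (intro sum.cong) auto
  then show ?thesis using polygons_at_vertex[OF assms(2)] by (simp add: mult.assoc)
qed

text \<open>Exactly one polygon at \<open>y\<close> leads back towards \<open>x\<close>; in the
  other \<open>r - 1\<close> polygons \<open>y\<close> is the gate.\<close>

lemma sum_neighbours_dist:
  fixes F :: "nat \<Rightarrow> 'b :: comm_semiring_1"
  assumes "r > 0" "x \<in> pverts G" "y \<in> pverts G" "x \<noteq> y"
  defines "m \<equiv> polygon_dist G k x y"
  shows "(\<Sum>z | z \<in> pverts G \<and> polygon_dist G k y z = 1. F (polygon_dist G k x z)) =
    F (m - 1) + of_nat (k - 2) * F m + of_nat ((r - 1) * (k - 1)) * F (Suc m)"
proof -
  let ?A = "{P. P \<in> polygons G k \<and> y \<in> \<Union>P}"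
  have "\<exists>!P. P \<in> ?A \<and> \<not> linked_off P x y"
    using ex1_polygon_towards[OF assms(2-4)] by simp
  then obtain P where P: "P \<in> ?A \<and> \<not> linked_off P x y"
    and uniq: "\<forall>P'. P' \<in> ?A \<and> \<not> linked_off P' x y \<longrightarrow> P' = P"
    by (rule ex1E)
  have fin: "finite ?A" using finite_polygons_at[OF assms(1,3)] .
  have "(\<Sum>z | z \<in> pverts G \<and> polygon_dist G k y z = 1. F (polygon_dist G k x z)) =
      (\<Sum>z \<in> \<Union>P - {y}. F (polygon_dist G k x z)) +
      (\<Sum>P \<in> ?A - {P}. \<Sum>z \<in> \<Union>P - {y}. F (polygon_dist G k x z))"
    unfolding sum_neighbours[OF assms(1,3)] using fin P by (intro sum.remove) simp_all
  also have "(\<Sum>P \<in> ?A - {P}. \<Sum>z \<in> \<Union>P - {y}. F (polygon_dist G k x z)) =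
      (\<Sum>P \<in> ?A - {P}. of_nat (k - 1) * F (Suc m))"
    unfolding m_def using uniq assms(2) by (intro sum.cong sum_polygon_away refl) auto
  also have "\<dots> = of_nat ((r - 1) * (k - 1)) * F (Suc m)"
    using polygons_at_vertex[OF assms(3)] fin P by (simp add: card_Diff_singleton mult.assoc)
  also have "(\<Sum>z \<in> \<Union>P - {y}. F (polygon_dist G k x z)) = F (m - 1) + of_nat (k - 2) * F m"
    unfolding m_def using P assms(2) by (intro sum_polygon_towards) auto
  finally show ?thesis .
qed

text \<open>The neighbour is the gate of the polygon that leads towards \<open>x\<close>; it
  supplies the induction step for the finiteness of balls.\<close>

lemma neighbour_towards:
  assumes "x \<in> pverts G" "y \<in> pverts G" "x \<noteq> y"
  obtains w where "w \<in> pverts G" "polygon_dist G k w y = 1"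
    "polygon_dist G k x y = Suc (polygon_dist G k x w)"
proof -
  obtain P where P: "P \<in> polygons G k" "y \<in> \<Union>P" "\<not> linked_off P x y"
    using ex1_implies_ex[OF ex1_polygon_towards[OF assms]] by blast
  obtain w where w: "w \<in> \<Union>P" "linked_off P x w"
    using ex1_implies_ex[OF ex1_gate[OF P(1) assms(1)]] by blast
  have "y \<noteq> w" using w(2) P(3) by blast
  moreover have "w \<in> pverts G" using w(1) polygon_vertices_subset[OF P(1)] by blast
  ultimately show ?thesis
    using that[of w] polygon_dist_eq_1_iff[of w y] assms(2) P w polygon_dist_Suc[OF P(1) assms(1) w(1) P(2) w(2)]
    by blast
qed

section \<open>Kernels that depend on the distance only\<close>

definition ball :: "'a \<Rightarrow> nat \<Rightarrow> 'a set" where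
  "ball x n = {y \<in> pverts G. polygon_dist G k x y \<le> n}"

text \<open>Sums over infinite sets take the default value 0; finiteness makes the sums over balls
  and spheres genuine.\<close>

lemma finite_ball:
  assumes "r > 0" "x \<in> pverts G"
  shows "finite (ball x n)"
proof (induction n)
  case 0
  have "ball x 0 \<subseteq> {x}"
    using polygon_dist_eq_0_iff[OF assms(2)] by (auto simp: ball_def)
  then show ?case by (rule finite_subset) simp
next
  case (Suc n)
  have "ball x (Suc n) \<subseteq>
      insert x (\<Union>w \<in> ball x n. {y. y \<in> pverts G \<and> polygon_dist G k w y = 1})"
  proof
    fix y assume y: "y \<in> ball x (Suc n)"
    show "y \<in> insert x (\<Union>w \<in> ball x n. {y. y \<in> pverts G \<and> polygon_dist G k w y = 1})"
    proof (cases "x = y")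
      case False
      then obtain w where "w \<in> pverts G" "polygon_dist G k w y = 1"
          "polygon_dist G k x y = Suc (polygon_dist G k x w)"
        using neighbour_towards[of x y] y assms(2) by (auto simp: ball_def)
      then show ?thesis using y by (auto simp: ball_def)
    qed simp
  qed
  moreover have "finite (insert x (\<Union>w \<in> ball x n. {y. y \<in> pverts G \<and> polygon_dist G k w y = 1}))"
    using Suc finite_neighbours[OF assms(1)] by (auto simp: ball_def)
  ultimately show ?case by (rule finite_subset)
qed

text \<open>The cut-off at \<open>n\<close> keeps the sum finite; it loses nothing when
  \<open>K\<close> vanishes beyond \<open>n\<close>.\<close>

definition radial_sum :: "nat \<Rightarrow> (nat \<Rightarrow> complex) \<Rightarrow> ('a \<Rightarrow> complex) \<Rightarrow> 'a \<Rightarrow> complex" where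
  "radial_sum n K f x = (\<Sum>y \<in> ball x n. K (polygon_dist G k x y) * f y)"

text \<open>The sum over neighbours acting on radial functions. The centre is separate because all
  \<open>r\<close> polygons lead away from it.\<close>

definition radial_step :: "(nat \<Rightarrow> complex) \<Rightarrow> nat \<Rightarrow> complex" where
  "radial_step K m =
    (if m = 0 then of_nat (r * (k - 1)) * K 1
     else K (m - 1) + of_nat (k - 2) * K m + of_nat ((r - 1) * (k - 1)) * K (Suc m))"

lemma radial_sum_extend:
  assumes "r > 0" "x \<in> pverts G" "n \<le> N" "\<And>m. n < m \<Longrightarrow> K m = 0"
  shows "radial_sum N K f x = radial_sum n K f x"
proof -
  have "m \<le> n" if "K m \<noteq> 0" for m using assms(4)[of m] that by (meson not_le)
  then show ?thesis
    unfolding radial_sum_def using finite_ball[OF assms(1,2)] assms(3)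
    by (intro sum.mono_neutral_right) (auto simp: ball_def)
qed

text \<open>After the sums are exchanged, the inner one runs over the neighbours \<open>z\<close> of
  \<open>x\<close> with \<open>y\<close> fixed. By symmetry of the distance its terms are radial
  about \<open>y\<close>, so the neighbour counts apply with \<open>y\<close> as centre.\<close>

lemma sum_neighbours_radial_sum:
  assumes "r > 0" "x \<in> pverts G" "\<And>m. n < m \<Longrightarrow> K m = 0"
  shows "(\<Sum>z | z \<in> pverts G \<and> polygon_dist G k x z = 1. radial_sum n K f z) =
    radial_sum (Suc n) (radial_step K) f x"
proof -
  let ?N = "{z. z \<in> pverts G \<and> polygon_dist G k x z = 1}"
  have supp: "m \<le> n" if "K m \<noteq> 0" for m using assms(3)[of m] that by (meson not_le)
  \<comment> \<open>All inner sums are extended to one common ball about \<open>x\<close>, so that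
    they can be exchanged with the sum over neighbours.\<close>
  have "radial_sum n K f z = (\<Sum>y \<in> ball x (Suc n). K (polygon_dist G k z y) * f y)" if "z \<in> ?N" for z
    unfolding radial_sum_def
  proof (rule sum.mono_neutral_left)
    show "finite (ball x (Suc n))" using finite_ball[OF assms(1,2)] .
    show "ball z n \<subseteq> ball x (Suc n)"
      using polygon_dist_triangle[OF assms(2), of z] that by (fastforce simp: ball_def)
    show "\<forall>y\<in>ball x (Suc n) - ball z n. K (polygon_dist G k z y) * f y = 0"
      using supp by (auto simp: ball_def)
  qed
  then have "(\<Sum>z \<in> ?N. radial_sum n K f z) =
      (\<Sum>z \<in> ?N. \<Sum>y \<in> ball x (Suc n). K (polygon_dist G k z y) * f y)"
    by (rule sum.cong[OF refl])
  also have "\<dots> = (\<Sum>y \<in> ball x (Suc n). (\<Sum>z \<in> ?N. K (polygon_dist G k z y)) * f y)"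
    by (subst sum.swap) (simp add: sum_distrib_right)
  also have "\<dots> = radial_sum (Suc n) (radial_step K) f x"
    unfolding radial_sum_def
  proof (rule sum.cong[OF refl])
    fix y assume "y \<in> ball x (Suc n)"
    then have y: "y \<in> pverts G" by (simp add: ball_def)
    have "(\<Sum>z \<in> ?N. K (polygon_dist G k z y)) = (\<Sum>z \<in> ?N. K (polygon_dist G k y z))"
      using y by (intro sum.cong) (auto simp: polygon_dist_sym)
    also have "\<dots> = radial_step K (polygon_dist G k x y)"
    proof (cases "x = y")
      case True
      then show ?thesis
        using sum_neighbours_dist_refl[OF assms(1,2), of K] polygon_dist_eq_0_iff[OF assms(2) y]
        by (simp add: radial_step_def)
    next
      case False
      then show ?thesis
        using sum_neighbours_dist[OF assms(1) y assms(2), of K] polygon_dist_eq_0_iff[OF assms(2) y]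
        by (simp add: radial_step_def polygon_dist_sym[OF y assms(2)])
    qed
    finally show "(\<Sum>z \<in> ?N. K (polygon_dist G k z y)) * f y =
        radial_step K (polygon_dist G k x y) * f y" by simp
  qed
  finally show ?thesis .
qed

end

section \<open>The wave equation for radial kernels\<close>

text \<open>Up to the power of \<open>q\<close> the weight depends only on the depth
  \<open>n - m\<close> below the outermost sphere.\<close>

definition profile_kernel :: "complex \<Rightarrow> (nat \<Rightarrow> complex) \<Rightarrow> nat \<Rightarrow> nat \<Rightarrow> complex" where
  "profile_kernel q c n m = (if m \<le> n then c (n - m) / q ^ n else 0)"

text \<open>Both \<open>1\<close> and \<open>1 - \<kappa>\<close> are roots of the characteristic
  polynomial. The closed form is demanded only from index \<open>n\<close> on, since
  \<open>coeff_f\<close> is exceptional at 0.\<close>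

lemma constant_plus_geometric_rec:
  fixes \<kappa> :: "'a :: comm_ring_1"
  assumes "\<And>i. i \<ge> n \<Longrightarrow> c i = a + b * (1 - \<kappa>) ^ i"
  shows "(\<kappa> - 1) * c n - (\<kappa> - 2) * c (Suc n) - c (Suc (Suc n)) = 0"
proof -
  have "(\<kappa> - 1) * (a + b * w) - (\<kappa> - 2) * (a + b * ((1 - \<kappa>) * w))
      - (a + b * ((1 - \<kappa>) * ((1 - \<kappa>) * w))) = 0" for w
    by (simp add: algebra_simps)
  then show ?thesis by (simp add: assms)
qed

context symmetric_graph
begin

text \<open>For \<open>m > 0\<close> the terms cancel whatever \<open>c\<close> is: one sphere
  inwards at time \<open>n\<close> has the same depth as \<open>m\<close> at time
  \<open>n + 1\<close>, and one sphere outwards the same as \<open>m\<close> at time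
  \<open>n - 1\<close>, with \<open>q\<^sup>2\<close> as the matching factor. Only the centre leaves
  a condition on \<open>c\<close>, where \<open>r (k - 1) - q\<^sup>2 = k - 1\<close> is the factor
  of \<open>c (n - 1)\<close>.\<close>

lemma radial_step_profile_kernel:
  fixes q :: complex
  assumes "k \<ge> 2" "r \<ge> 1" "q \<noteq> 0" "q\<^sup>2 = (of_nat r - 1) * (of_nat k - 1)" "n \<ge> 1"
  shows "radial_step (profile_kernel q c n) m - (of_nat k - 2) * profile_kernel q c n m =
    q * (profile_kernel q c (n + 1) m + profile_kernel q c (n - 1) m) +
    (if m = 0 then ((of_nat k - 1) * c (n - 1) - (of_nat k - 2) * c n - c (n + 1)) / q ^ n else 0)"
proof -
  have nats: "of_nat (k - 2) = (of_nat k - 2 :: complex)" "of_nat (k - 1) = (of_nat k - 1 :: complex)"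
    "of_nat (r - 1) = (of_nat r - 1 :: complex)"
    using assms(1,2) by (simp_all add: of_nat_diff)
  obtain n' where n: "n = Suc n'" using assms(5) by (cases n) auto
  have lower: "q * (a / q ^ n') = q\<^sup>2 * (a / q ^ n)" for a :: complex
    using assms(3) by (simp add: n power2_eq_square)
  have upper: "q * (a / q ^ (n + 1)) = a / q ^ n" for a :: complex
    using assms(3) by simp
  show ?thesis
  proof (cases m)
    case 0
    have sum: "q * (profile_kernel q c (n + 1) m + profile_kernel q c (n - 1) m) =
        c (n + 1) / q ^ n + q\<^sup>2 * (c (n - 1) / q ^ n)"
      unfolding distrib_left lower[symmetric] upper[symmetric] by (simp add: 0 profile_kernel_def n power2_eq_square)
    have step: "radial_step (profile_kernel q c n) m =
        of_nat r * (of_nat k - 1) * (c (n - 1) / q ^ n)"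
      by (simp add: 0 radial_step_def profile_kernel_def nats[unfolded One_nat_def] n)
    have "profile_kernel q c n m = c n / q ^ n" by (simp add: 0 profile_kernel_def)
    then show ?thesis
      unfolding sum step assms(4) using 0 by (simp add: algebra_simps diff_divide_distrib add_divide_distrib)
  next
    case (Suc m')
    have "radial_step (profile_kernel q c n) m - (of_nat k - 2) * profile_kernel q c n m =
        profile_kernel q c n m' + q\<^sup>2 * profile_kernel q c n (Suc m)"
      by (simp add: Suc radial_step_def nats nats[unfolded One_nat_def] assms(4))
    also have "profile_kernel q c n m' = q * profile_kernel q c (n + 1) m"
      using assms(3) by (simp add: Suc profile_kernel_def)
    also have "q\<^sup>2 * profile_kernel q c n (Suc m) = q * profile_kernel q c (n - 1) m"
      using lower[of "c (n' - m)"] by (simp add: profile_kernel_def n)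
    finally show ?thesis by (simp add: Suc distrib_left)
  qed
qed

section \<open>The coefficients belonging to the two initial data\<close>

definition coeff_f :: "nat \<Rightarrow> complex" where
  "coeff_f j = (if j = 0 then 1 / 2
    else - ((of_nat r - 1) * (of_nat k - 1) - 1 + (of_nat r - of_nat k) * (1 - of_nat k) ^ j)
      / (2 * of_nat k))"

text \<open>For \<open>k > 0\<close> this is the geometric sum of \<open>(1 - k) ^ i\<close> over
  \<open>i < j\<close>.\<close>

definition coeff_g :: "nat \<Rightarrow> complex" where
  "coeff_g j = (1 - (1 - of_nat k) ^ j) / of_nat k"

text \<open>From \<open>n = 2\<close> on only indices of at least 1 occur. At index 0 the closed
  form would give \<open>(2 - r) / 2\<close> instead of \<open>1 / 2\<close>.\<close>

lemma coeff_f_rec: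
  assumes "k \<ge> 2" "n \<ge> 2"
  shows "(of_nat k - 1) * coeff_f (n - 1) - (of_nat k - 2) * coeff_f n - coeff_f (n + 1) = 0"
proof -
  obtain n' where n: "n = Suc n'" "n' \<ge> 1" using assms(2) by (cases n) auto
  have "coeff_f j = - ((of_nat r - 1) * (of_nat k - 1) - 1) / (2 * of_nat k)
      + - (of_nat r - of_nat k) / (2 * of_nat k) * (1 - of_nat k) ^ j" if "j \<ge> n'" for j
  proof -
    have "- (A + B * w) / C = - A / C + - B / C * w" for A B C w :: complex
      by (simp add: diff_divide_distrib)
    moreover have "j \<noteq> 0" using n(2) that by simp
    ultimately show ?thesis unfolding coeff_f_def by (simp only: if_False)
  qed
  from constant_plus_geometric_rec[OF this] show ?thesis by (simp add: n(1))
qed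

text \<open>Here the exceptional value at 0 enters and leaves a defect, for which the kernel at time
  0 will make up.\<close>

lemma coeff_f_rec_1:
  assumes "k \<ge> 2"
  shows "(of_nat k - 1) * coeff_f 0 - (of_nat k - 2) * coeff_f 1 - coeff_f 2 =
    (of_nat r - 1) * (of_nat k - 1) / 2"
proof -
  have "(of_nat k :: complex) \<noteq> 0" using assms(1) by simp
  then show ?thesis by (simp add: coeff_f_def field_simps power2_eq_square)
qed

lemma coeff_g_rec:
  assumes "k \<ge> 2" "n \<ge> 1"
  shows "(of_nat k - 1) * coeff_g (n - 1) - (of_nat k - 2) * coeff_g n - coeff_g (n + 1) = 0"
proof -
  obtain n' where n: "n = Suc n'" using assms(2) by (cases n) auto
  have "coeff_g j = 1 / of_nat k + - 1 / of_nat k * (1 - of_nat k) ^ j" for j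
    by (simp add: coeff_g_def diff_divide_distrib)
  from constant_plus_geometric_rec[OF this] show ?thesis by (simp add: n)
qed

lemma coeff_f_1: "k \<ge> 2 \<Longrightarrow> coeff_f 1 = - (of_nat k - 2) / 2"
  by (simp add: coeff_f_def field_simps)

lemma coeff_g_1: "k \<ge> 2 \<Longrightarrow> coeff_g 1 = 1" and coeff_g_0: "coeff_g 0 = 0"
  by (simp_all add: coeff_g_def)

text \<open>The weight of the outermost sphere is \<open>1 / 2\<close> for \<open>n > 0\<close>, as the value \<open>f\<close> at time 0 is split
  evenly between \<open>n\<close> and \<open>-n\<close>; only for \<open>n = 0\<close> it is \<open>1\<close>.\<close>

definition kernel_f :: "complex \<Rightarrow> nat \<Rightarrow> nat \<Rightarrow> complex" where
  "kernel_f q n m = (if n = 0 then of_bool (m = 0) else profile_kernel q coeff_f n m)"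

text \<open>The additional \<open>q\<close> turns the power into \<open>q ^ (n - 1)\<close>, and
  \<open>coeff_g 0 = 0\<close> removes the outermost sphere, so for \<open>n > 0\<close> the
  effective radius is \<open>n - 1\<close>.\<close>

definition kernel_g :: "complex \<Rightarrow> nat \<Rightarrow> nat \<Rightarrow> complex" where
  "kernel_g q = profile_kernel q (\<lambda>j. q * coeff_g j)"

lemma kernel_f_step:
  assumes "k \<ge> 2" "r \<ge> 1" "q \<noteq> 0" "q\<^sup>2 = (of_nat r - 1) * (of_nat k - 1)" "n \<ge> 1"
  shows "q * (kernel_f q (n + 1) m + kernel_f q (n - 1) m) =
    radial_step (kernel_f q n) m - (of_nat k - 2) * kernel_f q n m"
proof (cases "n = 1")
  case True
  have "kernel_f q 1 = profile_kernel q coeff_f 1" by (simp add: kernel_f_def fun_eq_iff)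
  moreover have "kernel_f q 2 m = profile_kernel q coeff_f 2 m" by (simp add: kernel_f_def)
  \<comment> \<open>At \<open>m = 0\<close> the kernel at time 0 exceeds the profile by
    \<open>1 / 2\<close>; multiplied by \<open>q\<close> this is the defect from
    \<open>coeff_f_rec_1\<close>, divided by \<open>q\<close>.\<close>
  moreover have "q * kernel_f q 0 m = q * profile_kernel q coeff_f 0 m + (if m = 0 then q\<^sup>2 / 2 / q else 0)"
    using assms(3) by (simp add: kernel_f_def profile_kernel_def coeff_f_def power2_eq_square)
  moreover have rec: "(of_nat k - 1) * coeff_f (1 - 1) - (of_nat k - 2) * coeff_f 1 - coeff_f (1 + 1)
      = q\<^sup>2 / 2"
    using coeff_f_rec_1[OF assms(1)] assms(4) by (simp add: numeral_2_eq_2)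
  ultimately show ?thesis
    using radial_step_profile_kernel[OF assms(1-4), of 1 coeff_f m, unfolded rec]
    by (simp add: True numeral_2_eq_2 distrib_left)
next
  case False
  then have "n \<ge> 2" using assms(5) by simp
  then have "kernel_f q n = profile_kernel q coeff_f n"
      "kernel_f q (n + 1) = profile_kernel q coeff_f (n + 1)"
      "kernel_f q (n - 1) = profile_kernel q coeff_f (n - 1)"
    by (simp_all add: kernel_f_def fun_eq_iff)
  then show ?thesis
    using radial_step_profile_kernel[OF assms, of coeff_f m] coeff_f_rec[OF assms(1) \<open>n \<ge> 2\<close>] by simp
qed

text \<open>Times 1 and -1 carry the same kernel of \<open>f\<close>, so the equation at time 0
  determines it; this forces \<open>coeff_f 0 = 1 / 2\<close> and
  \<open>coeff_f 1 = - (k - 2) / 2\<close>.\<close>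

lemma kernel_f_step_0:
  assumes "k \<ge> 2" "q \<noteq> 0"
  shows "q * (kernel_f q 1 m + kernel_f q 1 m) =
    radial_step (kernel_f q 0) m - (of_nat k - 2) * kernel_f q 0 m"
proof -
  consider "m = 0" | "m = 1" | "m \<ge> 2" by linarith
  moreover have "coeff_f (Suc 0) = - (of_nat k - 2) / 2" "coeff_f 0 = 1 / 2"
    using coeff_f_1[OF assms(1)] by (simp_all add: coeff_f_def)
  ultimately show ?thesis
    using assms(2) by cases (auto simp: kernel_f_def radial_step_def profile_kernel_def mult.commute[of 2])
qed

lemma kernel_g_step:
  assumes "k \<ge> 2" "r \<ge> 1" "q \<noteq> 0" "q\<^sup>2 = (of_nat r - 1) * (of_nat k - 1)" "n \<ge> 1"
  shows "q * (kernel_g q (n + 1) m + kernel_g q (n - 1) m) =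
    radial_step (kernel_g q n) m - (of_nat k - 2) * kernel_g q n m"
proof -
  have "(of_nat k - 1) * (q * coeff_g (n - 1)) - (of_nat k - 2) * (q * coeff_g n) - q * coeff_g (n + 1)
      = q * ((of_nat k - 1) * coeff_g (n - 1) - (of_nat k - 2) * coeff_g n - coeff_g (n + 1))"
    by (simp add: algebra_simps)
  also have "\<dots> = 0" using coeff_g_rec[OF assms(1,5)] by simp
  finally show ?thesis
    using radial_step_profile_kernel[OF assms, of "\<lambda>j. q * coeff_g j" m] by (simp add: kernel_g_def)
qed

lemma kernel_f_support: "n < m \<Longrightarrow> kernel_f q n m = 0"
  and kernel_g_support: "n < m \<Longrightarrow> kernel_g q n m = 0"
  and kernel_g_0: "kernel_g q 0 m = 0"
  by (auto simp: kernel_f_def kernel_g_def profile_kernel_def coeff_g_0)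

text \<open>All sums are widened to radius \<open>n + 1\<close>, where the identity between the
  kernels applies term by term. The radii \<open>a\<close> and \<open>b\<close> are left open so
  that time 0, where both are 1, is covered as well.\<close>

lemma radial_sum_wave_equation:
  assumes "r > 0" "x \<in> pverts G"
    and "\<And>m. n < m \<Longrightarrow> K m = 0" "\<And>m. a < m \<Longrightarrow> A m = 0" "\<And>m. b < m \<Longrightarrow> B m = 0"
    and "a \<le> Suc n" "b \<le> Suc n"
    and step: "\<And>m. q * (A m + B m) = radial_step K m - s * K m"
  shows "q * (radial_sum a A f x + radial_sum b B f x) =
    (\<Sum>z | z \<in> pverts G \<and> polygon_dist G k x z = 1. radial_sum n K f z) - s * radial_sum n K f x"
proof -
  have "q * (radial_sum a A f x + radial_sum b B f x) =
      q * (radial_sum (Suc n) A f x + radial_sum (Suc n) B f x)"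
    using assms by (simp add: radial_sum_extend[of x _ "Suc n"])
  also have "\<dots> = (\<Sum>y \<in> ball x (Suc n).
      q * (A (polygon_dist G k x y) + B (polygon_dist G k x y)) * f y)"
    unfolding radial_sum_def by (simp add: sum.distrib sum_distrib_left algebra_simps)
  also have "\<dots> = radial_sum (Suc n) (radial_step K) f x - s * radial_sum (Suc n) K f x"
    unfolding radial_sum_def step by (simp add: sum_subtractf sum_distrib_left algebra_simps)
  also have "radial_sum (Suc n) K f x = radial_sum n K f x"
    using assms by (intro radial_sum_extend) auto
  also have "radial_sum (Suc n) (radial_step K) f x =
      (\<Sum>z | z \<in> pverts G \<and> polygon_dist G k x z = 1. radial_sum n K f z)"
    using assms by (intro sum_neighbours_radial_sum[symmetric]) auto
  finally show ?thesis .
qed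

section \<open>Existence and uniqueness for the Cauchy problem\<close>

definition wave_solution ::
    "complex \<Rightarrow> ('a \<Rightarrow> complex) \<Rightarrow> ('a \<Rightarrow> complex) \<Rightarrow> 'a \<Rightarrow> int \<Rightarrow> complex" where
  "wave_solution q f g x n =
    radial_sum (nat \<bar>n\<bar>) (kernel_f q (nat \<bar>n\<bar>)) f x
    + of_int (sgn n) * radial_sum (nat \<bar>n\<bar>) (kernel_g q (nat \<bar>n\<bar>)) g x"

text \<open>The equation of the Cauchy problem multiplied by \<open>r (k - 1)\<close>; the constant
  comes from \<open>r (k - 1) - (r - 1) (k - 1) - 1 = k - 2\<close>.\<close>

definition wave_recurrence :: "complex \<Rightarrow> ('a \<Rightarrow> int \<Rightarrow> complex) \<Rightarrow> 'a \<Rightarrow> int \<Rightarrow> bool" where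
  "wave_recurrence q u x n \<longleftrightarrow>
    q * (u x (n + 1) + u x (n - 1)) =
      (\<Sum>z | z \<in> pverts G \<and> polygon_dist G k x z = 1. u z n) - (of_nat k - 2) * u x n"

text \<open>The \<open>f\<close>-part is even and the \<open>g\<close>-part odd in time, so the
  kernel identities for nonnegative times suffice.\<close>

lemma wave_solution_recurrence:
  assumes "k \<ge> 2" "r \<ge> 1" "q \<noteq> 0" "q\<^sup>2 = (of_nat r - 1) * (of_nat k - 1)" "x \<in> pverts G"
  shows "wave_recurrence q (wave_solution q f g) x n"
proof -
  define F where "F N x = radial_sum N (kernel_f q N) f x" for N x
  define H where "H N x = radial_sum N (kernel_g q N) g x" for N x
  let ?\<Sigma> = "\<lambda>h. \<Sum>z | z \<in> pverts G \<and> polygon_dist G k x z = 1. h z"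
  have "r > 0" using assms(2) by simp
  have H_0: "H 0 x = 0" for x by (simp add: H_def radial_sum_def kernel_g_0)
  have sol: "wave_solution q f g z n = F (nat \<bar>n\<bar>) z + of_int (sgn n) * H (nat \<bar>n\<bar>) z" for z n
    by (simp add: wave_solution_def F_def H_def)
  have F: "q * (F (N + 1) x + F (N - 1) x) =
      (\<Sum>z | z \<in> pverts G \<and> polygon_dist G k x z = 1. F N z) - (of_nat k - 2) * F N x"
    if "N \<ge> 1" for N
    unfolding F_def
    by (rule radial_sum_wave_equation[OF \<open>r > 0\<close> assms(5) kernel_f_support kernel_f_support kernel_f_support])
      (use kernel_f_step[OF assms(1-4) that] in auto)
  have H: "q * (H (N + 1) x + H (N - 1) x) =
      (\<Sum>z | z \<in> pverts G \<and> polygon_dist G k x z = 1. H N z) - (of_nat k - 2) * H N x"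
    if "N \<ge> 1" for N
    unfolding H_def
    by (rule radial_sum_wave_equation[OF \<open>r > 0\<close> assms(5) kernel_g_support kernel_g_support kernel_g_support])
      (use kernel_g_step[OF assms(1-4) that] in auto)
  have F_0: "q * (F 1 x + F 1 x) =
      (\<Sum>z | z \<in> pverts G \<and> polygon_dist G k x z = 1. F 0 z) - (of_nat k - 2) * F 0 x"
    unfolding F_def
    by (rule radial_sum_wave_equation[OF \<open>r > 0\<close> assms(5) kernel_f_support kernel_f_support kernel_f_support])
      (use kernel_f_step_0[OF assms(1,3)] in auto)
  show ?thesis
  proof (cases "n = 0")
    case True
    \<comment> \<open>At time 0 the contributions of \<open>g\<close> from times 1 and -1 are
      opposite and cancel.\<close>
    then show ?thesis
      unfolding wave_recurrence_def using F_0 by (simp add: sol H_0)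
  next
    case False
    define N where "N = nat \<bar>n\<bar>"
    have N: "N \<ge> 1" using False by (simp add: N_def)
    \<comment> \<open>For \<open>n = 1\<close> and \<open>n = -1\<close> one adjacent time is 0,
      where \<open>sgn\<close> is 0 instead of the sign of \<open>n\<close>;
      \<open>H 0 x = 0\<close> makes this harmless.\<close>
    have neighbours: "wave_solution q f g x (n + 1) + wave_solution q f g x (n - 1) =
        (F (N + 1) x + F (N - 1) x) + of_int (sgn n) * (H (N + 1) x + H (N - 1) x)"
    proof (cases "n > 0")
      case True
      then have eqs: "nat \<bar>n + 1\<bar> = N + 1" "nat \<bar>n - 1\<bar> = N - 1" "sgn (n + 1) = 1" "sgn n = 1"
        and "sgn (n - 1) = 1 \<or> N - 1 = 0"
        by (auto simp: N_def sgn_if)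
      then have "of_int (sgn (n - 1)) * H (N - 1) x = H (N - 1) x" using H_0 by auto
      then show ?thesis unfolding sol eqs by simp
    next
      case False
      then have eqs: "nat \<bar>n + 1\<bar> = N - 1" "nat \<bar>n - 1\<bar> = N + 1" "sgn (n - 1) = -1" "sgn n = -1"
        and "sgn (n + 1) = -1 \<or> N - 1 = 0"
        using \<open>n \<noteq> 0\<close> by (auto simp: N_def sgn_if)
      then have "of_int (sgn (n + 1)) * H (N - 1) x = - H (N - 1) x" using H_0 by auto
      then show ?thesis unfolding sol eqs by simp
    qed
    have "q * (wave_solution q f g x (n + 1) + wave_solution q f g x (n - 1)) =
        q * (F (N + 1) x + F (N - 1) x) + of_int (sgn n) * (q * (H (N + 1) x + H (N - 1) x))"
      unfolding neighbours by (simp only: distrib_left mult.left_commute)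
    also have "\<dots> = ?\<Sigma> (F N) - (of_nat k - 2) * F N x
        + of_int (sgn n) * (?\<Sigma> (H N) - (of_nat k - 2) * H N x)"
      by (simp only: F[OF N] H[OF N])
    also have "\<dots> = (?\<Sigma> (F N) + of_int (sgn n) * ?\<Sigma> (H N))
        - (of_nat k - 2) * (F N x + of_int (sgn n) * H N x)"
      by (simp only: distrib_left right_diff_distrib mult.left_commute diff_add_eq add_diff_eq
        diff_diff_eq add.commute add.left_commute)
    also have "\<dots> = ?\<Sigma> (\<lambda>z. wave_solution q f g z n) - (of_nat k - 2) * wave_solution q f g x n"
      by (simp only: sol N_def[symmetric] sum.distrib sum_distrib_left)
    finally show ?thesis unfolding wave_recurrence_def .
  qed
qed

lemma ball_0: "x \<in> pverts G \<Longrightarrow> ball x 0 = {x}"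
  using polygon_dist_eq_0_iff by (auto simp: ball_def)

lemma wave_solution_initial:
  assumes "k \<ge> 2" "r \<ge> 1" "q \<noteq> 0" "x \<in> pverts G"
  shows "wave_solution q f g x 0 = f x"
    and "(wave_solution q f g x 1 - wave_solution q f g x (-1)) / 2 = g x"
proof -
  have dist_self: "polygon_dist G k x x = 0" using polygon_dist_eq_0_iff assms(4) by blast
  show "wave_solution q f g x 0 = f x"
    by (simp add: wave_solution_def radial_sum_def ball_0[OF assms(4)] dist_self kernel_f_def)
  \<comment> \<open>The sphere of radius 1 has weight \<open>coeff_g 0 = 0\<close>, so only the
    centre remains.\<close>
  have "radial_sum 1 (kernel_g q 1) g x = radial_sum 0 (kernel_g q 1) g x"
    using assms(2,4) by (intro radial_sum_extend) (auto simp: kernel_g_def profile_kernel_def coeff_g_0)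
  also have "\<dots> = g x"
    using coeff_g_1[OF assms(1)] assms(3)
    by (simp add: radial_sum_def ball_0[OF assms(4)] dist_self kernel_g_def profile_kernel_def)
  finally show "(wave_solution q f g x 1 - wave_solution q f g x (-1)) / 2 = g x"
    by (simp add: wave_solution_def)
qed

text \<open>At time 0 the recurrence gives the sum of the values at times 1 and -1, and the initial
  data give their difference. From there the recurrence extends the equality in both directions; it
  must be known at all vertices at once because neighbours enter.\<close>

lemma wave_recurrence_unique:
  assumes "q \<noteq> 0"
    and u: "\<And>x n. x \<in> pverts G \<Longrightarrow> wave_recurrence q u x n"
    and v: "\<And>x n. x \<in> pverts G \<Longrightarrow> wave_recurrence q v x n"
    and init: "\<And>x. x \<in> pverts G \<Longrightarrow> u x 0 = v x 0"
      "\<And>x. x \<in> pverts G \<Longrightarrow> u x 1 - u x (-1) = v x 1 - v x (-1)"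
    and "x \<in> pverts G"
  shows "u x n = v x n"
proof -
  let ?E = "\<lambda>n. \<forall>x \<in> pverts G. u x n = v x n"
  have sums: "u x (n + 1) + u x (n - 1) = v x (n + 1) + v x (n - 1)" if "?E n" "x \<in> pverts G" for n x
  proof -
    have "q * (u x (n + 1) + u x (n - 1)) = q * (v x (n + 1) + v x (n - 1))"
    proof -
      have "(\<Sum>z | z \<in> pverts G \<and> polygon_dist G k x z = 1. u z n) =
          (\<Sum>z | z \<in> pverts G \<and> polygon_dist G k x z = 1. v z n)"
        using that(1) by (intro sum.cong) auto
      then show ?thesis
        using u[OF that(2), of n] v[OF that(2), of n] that unfolding wave_recurrence_def by simp
    qed
    then show ?thesis using assms(1) by simp
  qed
  have E1: "?E 1" "?E (-1)"
  proof -
    have "u x 1 = v x 1 \<and> u x (-1) = v x (-1)" if "x \<in> pverts G" for x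
    proof -
      have "u x 1 + u x (-1) = v x 1 + v x (-1)" using sums[of 0 x] init(1) that by simp
      moreover have "u x 1 - u x (-1) = v x 1 - v x (-1)" using init(2) that .
      ultimately have "2 * u x 1 = 2 * v x 1" by algebra
      then show ?thesis using \<open>u x 1 + u x (-1) = v x 1 + v x (-1)\<close> by simp
    qed
    then show "?E 1" "?E (-1)" by auto
  qed
  \<comment> \<open>The recurrence has order two in time, so the induction carries two consecutive
    times in each direction.\<close>
  have "?E (int N) \<and> ?E (- int N) \<and> ?E (int N + 1) \<and> ?E (- int N - 1)" for N
  proof (induction N)
    case 0
    then show ?case using init(1) E1 by simp
  next
    case (Suc N)
    have up: "?E (int N + 1 + 1)"
      using sums[of "int N + 1"] Suc by simp
    have down: "?E (- int N - 1 - 1)"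
      using sums[of "- int N - 1"] Suc by simp
    have eqs: "int (Suc N) = int N + 1" "- (int N + 1) = - int N - 1" by simp_all
    show ?case unfolding eqs using up down Suc by blast
  qed
  from this[of "nat \<bar>n\<bar>"] show ?thesis
    using assms(6) by (cases "n \<ge> 0") auto
qed

lemma solves_cauchy_problem_iff_recurrence:
  fixes \<alpha> \<beta> q :: real
  assumes "k \<ge> 2" "r \<ge> 1"
    and "\<alpha> = ((real r - 1) * (real k - 1) + 1) / (real r * (real k - 1))"
    and "\<beta> = 2 * q / (real r * (real k - 1))"
  shows "solves_cauchy_problem G k r \<alpha> \<beta> f g u \<longleftrightarrow>
    (\<forall>x \<in> pverts G. (\<forall>n. wave_recurrence (complex_of_real q) u x n) \<and>
      u x 0 = f x \<and> (u x 1 - u x (-1)) / 2 = g x)"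
proof -
  have "complex_of_real \<beta> * laplacian_int (\<lambda>m. u x m) n =
      laplacian_graph G k r (\<lambda>y. u y n) x - complex_of_real (\<alpha> - \<beta>) * u x n \<longleftrightarrow>
      wave_recurrence (complex_of_real q) u x n" for x n
  proof -
    define S where "S = (\<Sum>z | z \<in> pverts G \<and> polygon_dist G k x z = 1. u z n)"
    define D :: complex where "D = of_nat r * (of_nat k - 1)"
    have "of_nat k \<noteq> (1 :: complex)" using assms(1) of_nat_eq_1_iff[of k] by simp
    then have D: "D \<noteq> 0" using assms(2) by (simp add: D_def)
    have \<alpha>: "complex_of_real \<alpha> = ((of_nat r - 1) * (of_nat k - 1) + 1) / D"
      and \<beta>: "complex_of_real \<beta> = 2 * q / D"
      by (simp_all add: assms(3,4) D_def)
    have "complex_of_real \<beta> * laplacian_int (\<lambda>m. u x m) n =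
      laplacian_graph G k r (\<lambda>y. u y n) x - complex_of_real (\<alpha> - \<beta>) * u x n \<longleftrightarrow>
      D * (complex_of_real \<beta> * laplacian_int (\<lambda>m. u x m) n) =
      D * (laplacian_graph G k r (\<lambda>y. u y n) x - complex_of_real (\<alpha> - \<beta>) * u x n)"
      using D by simp
    also have "D * (complex_of_real \<beta> * laplacian_int (\<lambda>m. u x m) n) =
        2 * q * u x n - q * (u x (n + 1) + u x (n - 1))"
      using D by (simp add: \<beta> laplacian_int_def field_simps)
    also have "D * (laplacian_graph G k r (\<lambda>y. u y n) x - complex_of_real (\<alpha> - \<beta>) * u x n) =
        D * u x n - S - (((of_nat r - 1) * (of_nat k - 1) + 1) - 2 * q) * u x n"
      using D unfolding laplacian_graph_def S_def[symmetric] D_def[symmetric] of_real_diff \<alpha> \<beta>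
      by (simp add: field_simps)
    finally show ?thesis
      unfolding wave_recurrence_def S_def[symmetric] D_def by (auto simp: algebra_simps)
  qed
  then show ?thesis unfolding solves_cauchy_problem_def by simp
qed

lemma solves_cauchy_problem_iff:
  fixes \<alpha> \<beta> q :: real
  assumes "k \<ge> 2" "r \<ge> 1" "q \<noteq> 0" "q\<^sup>2 = (real r - 1) * (real k - 1)"
    and "\<alpha> = ((real r - 1) * (real k - 1) + 1) / (real r * (real k - 1))"
    and "\<beta> = 2 * q / (real r * (real k - 1))"
  shows "solves_cauchy_problem G k r \<alpha> \<beta> f g u \<longleftrightarrow>
    (\<forall>x \<in> pverts G. \<forall>n. u x n = wave_solution (complex_of_real q) f g x n)"
proof -
  let ?q = "complex_of_real q"
  have q: "?q \<noteq> 0" using assms(3) by simp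
  have "?q\<^sup>2 = complex_of_real ((real r - 1) * (real k - 1))"
    by (simp only: assms(4)[symmetric] of_real_power)
  then have q2: "?q\<^sup>2 = (of_nat r - 1) * (of_nat k - 1)" by simp
  note rec = wave_solution_recurrence[OF assms(1,2) q q2, of _ f g]
  note init = wave_solution_initial[OF assms(1,2) q, of _ f g]
  note iff = solves_cauchy_problem_iff_recurrence[OF assms(1,2,5,6), of f g]
  show ?thesis
  proof
    assume "solves_cauchy_problem G k r \<alpha> \<beta> f g u"
    then have u: "\<forall>x \<in> pverts G. (\<forall>n. wave_recurrence ?q u x n) \<and>
        u x 0 = f x \<and> (u x 1 - u x (-1)) / 2 = g x"
      unfolding iff .
    show "\<forall>x \<in> pverts G. \<forall>n. u x n = wave_solution ?q f g x n"
    proof (intro ballI allI)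
      fix x n assume "x \<in> pverts G"
      then show "u x n = wave_solution ?q f g x n"
      proof (rule wave_recurrence_unique[OF q, rotated -1])
        fix x assume "x \<in> pverts G"
        then show "u x 0 = wave_solution ?q f g x 0"
          using u init(1) by simp
        have "(u x 1 - u x (-1)) / 2 = (wave_solution ?q f g x 1 - wave_solution ?q f g x (-1)) / 2"
          using u init(2) \<open>x \<in> pverts G\<close> by simp
        then show "u x 1 - u x (-1) = wave_solution ?q f g x 1 - wave_solution ?q f g x (-1)"
          unfolding divide_cancel_right by simp
      qed (use u rec in auto)
    qed
  next
    assume u: "\<forall>x \<in> pverts G. \<forall>n. u x n = wave_solution ?q f g x n"
    \<comment> \<open>\<open>u\<close> is known on the vertices only, which suffices because the sum
      over neighbours ranges over vertices.\<close>
    have u_rec: "wave_recurrence ?q u x n" if "x \<in> pverts G" for x n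
    proof -
      have "(\<Sum>z | z \<in> pverts G \<and> polygon_dist G k x z = 1. u z n) =
          (\<Sum>z | z \<in> pverts G \<and> polygon_dist G k x z = 1. wave_solution ?q f g z n)"
        using u by (intro sum.cong) auto
      then show ?thesis using rec[OF that, of n] u that unfolding wave_recurrence_def by simp
    qed
    then show "solves_cauchy_problem G k r \<alpha> \<beta> f g u"
      unfolding iff using u init by (auto intro: u_rec)
  qed
qed

section \<open>The solution written out by spheres\<close>

definition sphere_sum :: "('a \<Rightarrow> complex) \<Rightarrow> 'a \<Rightarrow> nat \<Rightarrow> complex" where
  "sphere_sum f x l = (\<Sum>y | y \<in> pverts G \<and> polygon_dist G k x y = l. f y)"

lemma sum_sphere_sum:
  assumes "r > 0" "x \<in> pverts G"
  shows "(\<Sum>l<n. c l * sphere_sum f x l) =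
    (\<Sum>y | y \<in> pverts G \<and> polygon_dist G k x y < n. c (polygon_dist G k x y) * f y)"
proof -
  let ?B = "{y. y \<in> pverts G \<and> polygon_dist G k x y < n}"
  have "finite ?B" by (rule finite_subset[OF _ finite_ball[OF assms, of n]]) (auto simp: ball_def)
  then have "(\<Sum>y \<in> ?B. c (polygon_dist G k x y) * f y) =
      (\<Sum>l<n. \<Sum>y \<in> {y \<in> ?B. polygon_dist G k x y = l}. c (polygon_dist G k x y) * f y)"
    by (intro sum.group[symmetric]) auto
  also have "\<dots> = (\<Sum>l<n. c l * sphere_sum f x l)"
    unfolding sphere_sum_def sum_distrib_left by (intro sum.cong) auto
  finally show ?thesis by simp
qed

lemma radial_sum_eq_sphere_sums:
  assumes "r > 0" "x \<in> pverts G"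
  shows "radial_sum n K f x = K n * sphere_sum f x n + (\<Sum>l<n. K l * sphere_sum f x l)"
proof -
  have "ball x n = {y. y \<in> pverts G \<and> polygon_dist G k x y < Suc n}"
    by (auto simp: ball_def)
  then show ?thesis
    using sum_sphere_sum[OF assms, of K f "Suc n"] by (simp add: radial_sum_def add.commute)
qed

text \<open>The radii \<open>N\<close> for \<open>f\<close> and \<open>N - 1\<close> for
  \<open>g\<close> stand apart: the coefficients there are \<open>coeff_f 0 = 1 / 2\<close>, which
  is outside the closed form, and \<open>coeff_g 1 = 1\<close>.\<close>

lemma wave_solution_explicit:
  assumes "k \<ge> 2" "r \<ge> 1" "q \<noteq> 0" "x \<in> pverts G" "n \<noteq> 0" "N = nat \<bar>n\<bar>"
  shows "wave_solution q f g x n =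
      1/2 * (1 / q ^ N) * sphere_sum f x N
    - 1 / (2 * of_nat k) * (1 / q ^ N) *
        (\<Sum>l \<in> {0..<N}. ((of_nat r - 1) * (of_nat k - 1) - 1
            + (of_nat r - of_nat k) * (1 - of_nat k) ^ (N - l)) * sphere_sum f x l)
    + of_int (sgn n) * (1 / q ^ (N - 1)) * sphere_sum g x (N - 1)
    + of_int (sgn n) * (1 / of_nat k) * (1 / q ^ (N - 1)) *
        ((\<Sum>y | y \<in> pverts G \<and> polygon_dist G k x y < N - 1. g y)
         - (\<Sum>l \<in> {0..<N - 1}. (1 - of_nat k) ^ (N - l) * sphere_sum g x l))"
proof -
  have r: "r > 0" using assms(2) by simp
  obtain M where N: "N = Suc M" using assms(5,6) not0_implies_Suc[of N] by auto
  have "kernel_f q N N = 1 / 2 * (1 / q ^ N)"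
    by (simp add: kernel_f_def profile_kernel_def coeff_f_def N)
  moreover have "kernel_f q N l = - (1 / (2 * of_nat k) * (1 / q ^ N)) *
      ((of_nat r - 1) * (of_nat k - 1) - 1 + (of_nat r - of_nat k) * (1 - of_nat k) ^ (N - l))"
    if "l < N" for l
  proof -
    have "kernel_f q N l = coeff_f (N - l) / q ^ N" using that by (simp add: kernel_f_def profile_kernel_def)
    moreover have "- a / b / c = - (1 / b * (1 / c)) * a" for a b c :: complex by simp
    moreover have "N - l \<noteq> 0" using that by simp
    ultimately show ?thesis by (simp only: coeff_f_def if_False)
  qed
  ultimately have F: "radial_sum N (kernel_f q N) f x = 1/2 * (1 / q ^ N) * sphere_sum f x N
    - 1 / (2 * of_nat k) * (1 / q ^ N) *
        (\<Sum>l<N. ((of_nat r - 1) * (of_nat k - 1) - 1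
            + (of_nat r - of_nat k) * (1 - of_nat k) ^ (N - l)) * sphere_sum f x l)"
    unfolding radial_sum_eq_sphere_sums[OF r assms(4)] sum_distrib_left
    by (simp add: mult.assoc sum_negf)
  have "kernel_g q N M = 1 / q ^ M"
    using assms(3) coeff_g_1[OF assms(1)] by (simp add: kernel_g_def profile_kernel_def N)
  moreover have "kernel_g q N l = 1 / of_nat k * (1 / q ^ M) * (1 - (1 - of_nat k) ^ (N - l))"
    if "l < M" for l
    using that assms(3) by (simp add: kernel_g_def profile_kernel_def coeff_g_def N)
  \<comment> \<open>The radial sum reaches radius \<open>N\<close>, but the top term vanishes and
    \<open>M\<close> becomes the outermost radius for \<open>g\<close>.\<close>
  moreover have "kernel_g q N N = 0" by (simp add: kernel_g_def profile_kernel_def coeff_g_0)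
  ultimately have "radial_sum N (kernel_g q N) g x = 1 / q ^ M * sphere_sum g x M +
      1 / of_nat k * (1 / q ^ M) *
        (\<Sum>l<M. (1 - (1 - of_nat k) ^ (N - l)) * sphere_sum g x l)"
    unfolding radial_sum_eq_sphere_sums[OF r assms(4)] sum_distrib_left
    by (simp add: N mult.assoc)
  also have "(\<Sum>l<M. (1 - (1 - of_nat k) ^ (N - l)) * sphere_sum g x l) =
      (\<Sum>y | y \<in> pverts G \<and> polygon_dist G k x y < M. g y)
      - (\<Sum>l<M. (1 - of_nat k) ^ (N - l) * sphere_sum g x l)"
    using sum_sphere_sum[OF r assms(4), of "\<lambda>_. 1" g M]
    by (simp add: left_diff_distrib sum_subtractf)
  finally have H: "radial_sum N (kernel_g q N) g x = 1 / q ^ M * sphere_sum g x M +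
      1 / of_nat k * (1 / q ^ M) * ((\<Sum>y | y \<in> pverts G \<and> polygon_dist G k x y < M. g y)
      - (\<Sum>l<M. (1 - of_nat k) ^ (N - l) * sphere_sum g x l))" .
  have M: "N - 1 = M" by (simp add: N)
  show ?thesis
    unfolding wave_solution_def assms(6)[symmetric] F H M atLeast0LessThan
    by (simp only: distrib_left mult.assoc add.assoc)
qed

end

text \<open>The equivalences express that the formula solves the problem and that every solution
  agrees with it on the vertices. For \<open>k = r\<close> the geometric terms of the
  \<open>f\<close>-part vanish, while those of the \<open>g\<close>-part keep the base
  \<open>1 - k\<close> and alternate in sign: \<open>- (1 - k) ^ j\<close> equals
  \<open>(k - 1) ^ j\<close> only for odd \<open>j\<close>.\<close>

theorem theorem4p3:
  fixes G :: "'a pair_pre_digraph" and k r :: nat and Q \<alpha> \<beta> :: real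
    and f g :: "'a \<Rightarrow> complex"
  assumes "k \<ge> 2" and "r \<ge> 2"
    and "symmetric_graph G k r"
    and "Q = (real r - 1) * (real k - 1)"
    and "\<alpha> = (Q + 1) / (real r * (real k - 1))"
    and "\<beta> = 2 * Q powr (1/2) / (real r * (real k - 1))"
  shows
    "(k < r \<longrightarrow> (\<forall>u :: 'a \<Rightarrow> int \<Rightarrow> complex.
        solves_cauchy_problem G k r \<alpha> \<beta> f g u \<longleftrightarrow>
        (\<forall>x \<in> pverts G. u x 0 = f x \<and> (\<forall>n. n \<noteq> 0 \<longrightarrow> u x n =
            1/2 * complex_of_real (Q powr (- \<bar>n\<bar> / 2)) *
              (\<Sum>y | y \<in> pverts G \<and> int (polygon_dist G k x y) = \<bar>n\<bar>. f y)
          - 1 / (2 * of_nat k) * complex_of_real (Q powr (- \<bar>n\<bar> / 2)) *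
              (\<Sum>l \<in> {0..<nat \<bar>n\<bar>}.
                complex_of_real (Q - 1 + (real r - real k) * (1 - real k) ^ (nat \<bar>n\<bar> - l)) *
                (\<Sum>y | y \<in> pverts G \<and> polygon_dist G k x y = l. f y))
          + of_int (sgn n) * complex_of_real (Q powr (- (\<bar>n\<bar> - 1) / 2)) *
              (\<Sum>y | y \<in> pverts G \<and> int (polygon_dist G k x y) = \<bar>n\<bar> - 1. g y)
          + of_int (sgn n) * (1 / of_nat k) * complex_of_real (Q powr (- (\<bar>n\<bar> - 1) / 2)) *
              ((\<Sum>y | y \<in> pverts G \<and> int (polygon_dist G k x y) < \<bar>n\<bar> - 1. g y)
               - (\<Sum>l \<in> {0..<nat (\<bar>n\<bar> - 1)}.
                   complex_of_real ((1 - real k) ^ (nat \<bar>n\<bar> - l)) *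
                   (\<Sum>y | y \<in> pverts G \<and> polygon_dist G k x y = l. g y)))))))
     \<and>
     (k = r \<longrightarrow> (\<forall>u :: 'a \<Rightarrow> int \<Rightarrow> complex.
        solves_cauchy_problem G k r \<alpha> \<beta> f g u \<longleftrightarrow>
        (\<forall>x \<in> pverts G. u x 0 = f x \<and> (\<forall>n. n \<noteq> 0 \<longrightarrow> u x n =
            1/2 * complex_of_real ((real k - 1) powi (- \<bar>n\<bar>)) *
              (\<Sum>y | y \<in> pverts G \<and> int (polygon_dist G k x y) = \<bar>n\<bar>. f y)
          - (of_nat k - 2) / 2 * complex_of_real ((real k - 1) powi (- \<bar>n\<bar>)) *
              (\<Sum>y | y \<in> pverts G \<and> int (polygon_dist G k x y) < \<bar>n\<bar>. f y)
          + of_int (sgn n) * complex_of_real ((real k - 1) powi (- (\<bar>n\<bar> - 1))) *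
              (\<Sum>y | y \<in> pverts G \<and> int (polygon_dist G k x y) = \<bar>n\<bar> - 1. g y)
          + of_int (sgn n) * (1 / of_nat k) * complex_of_real ((real k - 1) powi (- (\<bar>n\<bar> - 1))) *
              ((\<Sum>y | y \<in> pverts G \<and> int (polygon_dist G k x y) < \<bar>n\<bar> - 1. g y)
               - (\<Sum>l \<in> {0..<nat (\<bar>n\<bar> - 1)}.
                   complex_of_real ((1 - real k) ^ (nat \<bar>n\<bar> - l)) *
                   (\<Sum>y | y \<in> pverts G \<and> polygon_dist G k x y = l. g y)))))))"
proof -
  interpret symmetric_graph G k r by fact
  note k = assms(1)
  have r: "r \<ge> 1" using assms(2) by simp
  define q where "q = Q powr (1/2)"
  have "1 \<le> (real r - 1) * (real k - 1)"
    using assms(1,2) mult_mono[of 1 "real r - 1" 1 "real k - 1"] by simp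
  then have "Q > 0" using assms(4) by simp
  then have q: "q > 0" "q\<^sup>2 = Q" by (simp_all add: q_def powr_half_sqrt)
  \<comment> \<open>Half-integral powers of \<open>Q\<close> become integral powers of its square
    root \<open>q\<close>.\<close>
  have powr: "Q powr (- real m / 2) = 1 / q ^ m" for m
  proof -
    have "Q powr (- real m / 2) = inverse (Q powr (1/2 * real m))"
      by (simp add: powr_minus[symmetric])
    also have "Q powr (1/2 * real m) = q powr real m" by (simp only: q_def powr_powr)
    also have "\<dots> = q ^ m" using q(1) by (rule powr_realpow)
    finally show ?thesis by (simp only: inverse_eq_divide)
  qed
  define c where "c = complex_of_real q"
  have c: "c \<noteq> 0" "\<And>m. complex_of_real (1 / q ^ m) = 1 / c ^ m"
    using q(1) by (simp_all add: c_def)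
  have solves: "solves_cauchy_problem G k r \<alpha> \<beta> f g u \<longleftrightarrow>
      (\<forall>x \<in> pverts G. \<forall>n. u x n = wave_solution c f g x n)" for u
    unfolding c_def using assms q r by (intro solves_cauchy_problem_iff) (auto simp: q_def)
  \<comment> \<open>Time 0 is settled by the initial value, so a candidate \<open>U\<close> has to
    be compared with \<open>wave_solution\<close> at nonzero times only.\<close>
  have solves': "solves_cauchy_problem G k r \<alpha> \<beta> f g u \<longleftrightarrow>
      (\<forall>x \<in> pverts G. u x 0 = f x \<and> (\<forall>n. n \<noteq> 0 \<longrightarrow> u x n = U x n))"
    if "\<And>x n. x \<in> pverts G \<Longrightarrow> n \<noteq> 0 \<Longrightarrow> U x n = wave_solution c f g x n" for u U
    unfolding solves using that wave_solution_initial(1)[OF k r c(1)] by metis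
  \<comment> \<open>The theorem compares radii as integers. The equation with
    \<open>\<bar>n\<bar> - 1\<close> needs \<open>n \<noteq> 0\<close>, since at 0 the truncated
    difference would be 0 instead of -1.\<close>
  have abs_conv: "(int m = \<bar>n\<bar>) = (m = nat \<bar>n\<bar>)" "(int m < \<bar>n\<bar>) = (m < nat \<bar>n\<bar>)"
    "n \<noteq> 0 \<Longrightarrow> (int m = \<bar>n\<bar> - 1) = (m = nat \<bar>n\<bar> - 1)"
    "(int m < \<bar>n\<bar> - 1) = (m < nat \<bar>n\<bar> - 1)"
    "nat (\<bar>n\<bar> - 1) = nat \<bar>n\<bar> - 1" for m n
    by auto
  show ?thesis
  proof (intro conjI impI allI solves')
    fix x n assume x: "x \<in> pverts G" and n: "(n :: int) \<noteq> 0"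
    have "- \<bar>real_of_int n\<bar> = - real (nat \<bar>n\<bar>)" "- (\<bar>real_of_int n\<bar> - 1) = - real (nat \<bar>n\<bar> - 1)"
      using n by (auto simp: of_nat_diff)
    then have pow: "complex_of_real (Q powr (- \<bar>real_of_int n\<bar> / 2)) = 1 / c ^ nat \<bar>n\<bar>"
      "complex_of_real (Q powr (- (\<bar>real_of_int n\<bar> - 1) / 2)) = 1 / c ^ (nat \<bar>n\<bar> - 1)"
      by (simp_all only: powr c)
    show "1/2 * complex_of_real (Q powr (- \<bar>real_of_int n\<bar> / 2)) *
              (\<Sum>y | y \<in> pverts G \<and> int (polygon_dist G k x y) = \<bar>n\<bar>. f y)
          - 1 / (2 * of_nat k) * complex_of_real (Q powr (- \<bar>real_of_int n\<bar> / 2)) *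
              (\<Sum>l \<in> {0..<nat \<bar>n\<bar>}.
                complex_of_real (Q - 1 + (real r - real k) * (1 - real k) ^ (nat \<bar>n\<bar> - l)) *
                (\<Sum>y | y \<in> pverts G \<and> polygon_dist G k x y = l. f y))
          + of_int (sgn n) * complex_of_real (Q powr (- (\<bar>real_of_int n\<bar> - 1) / 2)) *
              (\<Sum>y | y \<in> pverts G \<and> int (polygon_dist G k x y) = \<bar>n\<bar> - 1. g y)
          + of_int (sgn n) * (1 / of_nat k) * complex_of_real (Q powr (- (\<bar>real_of_int n\<bar> - 1) / 2)) *
              ((\<Sum>y | y \<in> pverts G \<and> int (polygon_dist G k x y) < \<bar>n\<bar> - 1. g y)
               - (\<Sum>l \<in> {0..<nat (\<bar>n\<bar> - 1)}.
                   complex_of_real ((1 - real k) ^ (nat \<bar>n\<bar> - l)) *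
                   (\<Sum>y | y \<in> pverts G \<and> polygon_dist G k x y = l. g y)))
      = wave_solution c f g x n"
      unfolding wave_solution_explicit[OF k r c(1) x n refl] pow abs_conv abs_conv(3)[OF n]
        sphere_sum_def
      unfolding assms(4) by simp
  next
    fix x n assume x: "x \<in> pverts G" and n: "(n :: int) \<noteq> 0" and "k = r"
    \<comment> \<open>For \<open>r = k\<close> one has \<open>Q = (k - 1)\<^sup>2\<close>, and
      \<open>q\<close> is its positive root.\<close>
    have "q = real k - 1"
    proof -
      have "q\<^sup>2 = (real k - 1)\<^sup>2" using q(2) assms(4) \<open>k = r\<close> by (simp add: power2_eq_square)
      then show ?thesis using q(1) k by (simp add: power2_eq_iff)
    qed
    have nats: "- \<bar>n\<bar> = - int (nat \<bar>n\<bar>)" "- (\<bar>n\<bar> - 1) = - int (nat \<bar>n\<bar> - 1)"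
      using n by (auto simp: of_nat_diff)
    have pow: "complex_of_real ((real k - 1) powi (- int m)) = 1 / c ^ m" for m
      unfolding \<open>q = real k - 1\<close>[symmetric] power_int_minus
      by (simp add: c_def divide_inverse)
    \<comment> \<open>The factor \<open>r - k\<close> removes the geometric term, and
      \<open>(k - 1)\<^sup>2 - 1 = k (k - 2)\<close> is the same for all spheres, so the sum over
      spheres becomes a sum over the open ball.\<close>
    have coeff: "(of_nat r - 1) * (of_nat k - 1) - 1 + (of_nat r - of_nat k) * w =
        of_nat k * (of_nat k - 2 :: complex)" for w
      using \<open>k = r\<close> by (simp add: algebra_simps)
    have f_sum: "(\<Sum>l \<in> {0..<m}. of_nat k * (of_nat k - 2) * sphere_sum f x l) =
        of_nat k * (of_nat k - 2) * (\<Sum>y | y \<in> pverts G \<and> polygon_dist G k x y < m. f y)" for m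
      using sum_sphere_sum[OF _ x, of "\<lambda>_. 1" f m] r
      by (simp add: sum_distrib_left[symmetric] atLeast0LessThan)
    have cancel: "1 / (2 * of_nat k) * p * (of_nat k * (of_nat k - 2) * s) = (of_nat k - 2) / 2 * p * s"
      for p s :: complex using k by (simp add: field_simps)
    note explicit = wave_solution_explicit[OF k r c(1) x n refl, where f = f and g = g,
      unfolded coeff f_sum cancel]
    show "1/2 * complex_of_real ((real k - 1) powi (- \<bar>n\<bar>)) *
              (\<Sum>y | y \<in> pverts G \<and> int (polygon_dist G k x y) = \<bar>n\<bar>. f y)
          - (of_nat k - 2) / 2 * complex_of_real ((real k - 1) powi (- \<bar>n\<bar>)) *
              (\<Sum>y | y \<in> pverts G \<and> int (polygon_dist G k x y) < \<bar>n\<bar>. f y)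
          + of_int (sgn n) * complex_of_real ((real k - 1) powi (- (\<bar>n\<bar> - 1))) *
              (\<Sum>y | y \<in> pverts G \<and> int (polygon_dist G k x y) = \<bar>n\<bar> - 1. g y)
          + of_int (sgn n) * (1 / of_nat k) * complex_of_real ((real k - 1) powi (- (\<bar>n\<bar> - 1))) *
              ((\<Sum>y | y \<in> pverts G \<and> int (polygon_dist G k x y) < \<bar>n\<bar> - 1. g y)
               - (\<Sum>l \<in> {0..<nat (\<bar>n\<bar> - 1)}.
                   complex_of_real ((1 - real k) ^ (nat \<bar>n\<bar> - l)) *
                   (\<Sum>y | y \<in> pverts G \<and> polygon_dist G k x y = l. g y)))
      = wave_solution c f g x n"
      unfolding explicit nats pow abs_conv abs_conv(3)[OF n] sphere_sum_def by simp
  qed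
qed

end
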